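(* Let $(\mathbb{K},|\cdot|)$ be an algebraically closed normed field, let $f\in\mathbb{K}[z]$ be a polynomial of degree $n\ge 2$, let $N\ge 1$ be an integer and let $1\le p\le\infty$. Suppose $x^{(0)}\in\mathbb{K}^n$ is a vector with pairwise distinct components such that \[ E_f(x^{(0)})\le \frac{1}{(1+\sqrt{a})^2}\quad\text{and}\quad \Omega(E_f(x^{(0)}))<2, \] where $a=(n-1)^{1/q}$. In the case $n=2$ and $p=\infty$ assume moreover that the first inequality is strict. Then $f$ has only simple zeros in $\mathbb{K}$, and the $N$th Weierstrass-type iteration $x^{(k+1)}=T^{(N)}(x^{(k)})$ starting from $x^{(0)}$ is well-defined and converges to a root-vector $\xi$ of $f$ with order of convergence $N+1$, and the error estimate \[ \|x^{(k)}-\xi\|\preceq \alpha(E_f(x^{(k)}))\,\|W_f(x^{(k)})\| \] holds for every $k\ge 0$ such that $E_f(x^{(k)})\le 1/(1+\sqrt{a})^2$ and $\Omega(E_f(x^{(k)}))<2$.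
   Context: $(\mathbb{K},|\cdot|)$ is an algebraically closed normed field and $a_0$ denotes the leading coefficient of $f$. For $1\le p\le\infty$, $\|x\|_p=(\sum_{i=1}^n|x_i|^p)^{1/p}$ (with $\|x\|_\infty=\max_i|x_i|$), and $q\in[1,\infty]$ is the conjugate exponent, $1/p+1/q=1$. For $x\in\mathbb{K}^n$, $\|x\|=(|x_1|,\dots,|x_n|)\in\mathbb{R}^n$, and $\preceq$ is the coordinatewise order on $\mathbb{R}^n$ ($u\preceq v$ iff $u_i\le v_i$ for all $i$). For $x\in\mathbb{K}^n$, $d(x)=(d_1(x),\dots,d_n(x))$ with $d_i(x)=\min_{j\ne i}|x_i-x_j|$; for $x\in\mathbb{K}^n$ and $y\in\mathbb{R}^n$ with nonzero components, $x/y=(|x_1|/y_1,\dots,|x_n|/y_n)\in\mathbb{R}^n$. A vector $\xi\in\mathbb{K}^n$ is a root-vector of $f$ if $f(z)=a_0\prod_{i=1}^n(z-\xi_i)$ for all $z\in\mathbb{K}$. Weierstrass correction: for $x$ with distinct components, $W_f(x)=(W_1(x),\dots,W_n(x))$ with $W_i(x)=f(x_i)/\big(a_0\prod_{j\ne i}(x_i-x_j)\big)$, and $E_f(x)=\|W_f(x)/d(x)\|_p$. Weierstrass-type maps: $T^{(0)}(x)=x$ on $D_0=\mathbb{K}^n$; recursively, $D_{N+1}=\{x\in D_N : x_i\ne T^{(N)}_j(x)\text{ for all } i\ne j\}$ and, for $x\in D_{N+1}$ and $i=1,\dots,n$, $T^{(N+1)}_i(x)=x_i-\dfrac{f(x_i)}{a_0\prod_{j\ne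 i}(x_i-T^{(N)}_j(x))}$. The iteration $x^{(k+1)}=T^{(N)}(x^{(k)})$ is well-defined if $x^{(k)}\in D_N$ for all $k\ge0$. Real functions: $\Psi(t)=(1+2t)\left(1+\frac{t}{(n-1)^{1/p}}\right)^{n-1}$ for $t\ge0$ (where $(n-1)^{1/p}=1$ if $p=\infty$); $\alpha(t)=\dfrac{2}{1-(a-1)t+\sqrt{(1-(a-1)t)^2-4t}}$; $h(t)=t\,\alpha(t)$; $\Omega(t)=\Psi(h(t))$. *)

theory Defs
  imports Complex_Main "HOL-Computational_Algebra.Polynomial" "HOL-Library.Extended_Real"
begin

text \<open>An absolute value on a field: the norm of a normed field (K,|.|).
  This covers both archimedean and non-archimedean absolute values.\<close>
definition is_absval :: "('a::field \<Rightarrow> real) \<Rightarrow> bool" where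
  "is_absval av \<longleftrightarrow>
     (\<forall>x. av x \<ge> 0) \<and> (\<forall>x. av x = 0 \<longleftrightarrow> x = 0) \<and>
     (\<forall>x y. av (x * y) = av x * av y) \<and> (\<forall>x y. av (x + y) \<le> av x + av y)"

definition alg_closed_field :: "'a::field itself \<Rightarrow> bool" where
  "alg_closed_field _ \<longleftrightarrow> (\<forall>p :: 'a poly. degree p > 0 \<longrightarrow> (\<exists>z. poly p z = 0))"

text \<open>Vectors of K^n / R^n are functions on indices 0..n-1.\<close>

definition inv_exp :: "ereal \<Rightarrow> real" where
  "inv_exp p = (if p = \<infinity> then 0 else 1 / real_of_ereal p)"

definition pnorm :: "ereal \<Rightarrow> nat \<Rightarrow> (nat \<Rightarrow> real) \<Rightarrow> real" where
  "pnorm p n v = (if p = \<infinity> then Max ((\<lambda>i. \<bar>v i\<bar>) ` {..<n})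
                  else (\<Sum>i<n. \<bar>v i\<bar> powr real_of_ereal p) powr (1 / real_of_ereal p))"

definition W_corr :: "'a::field poly \<Rightarrow> nat \<Rightarrow> (nat \<Rightarrow> 'a) \<Rightarrow> nat \<Rightarrow> 'a" where
  "W_corr f n x i = poly f (x i) / (lead_coeff f * (\<Prod>j\<in>{..<n} - {i}. (x i - x j)))"

definition dmin :: "('a \<Rightarrow> real) \<Rightarrow> nat \<Rightarrow> (nat \<Rightarrow> 'a::field) \<Rightarrow> nat \<Rightarrow> real" where
  "dmin av n x i = Min ((\<lambda>j. av (x i - x j)) ` ({..<n} - {i}))"

definition E_f :: "('a::field \<Rightarrow> real) \<Rightarrow> ereal \<Rightarrow> 'a poly \<Rightarrow> nat \<Rightarrow> (nat \<Rightarrow> 'a) \<Rightarrow> real" where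
  "E_f av p f n x = pnorm p n (\<lambda>i. av (W_corr f n x i) / dmin av n x i)"

definition Psi :: "nat \<Rightarrow> ereal \<Rightarrow> real \<Rightarrow> real" where
  "Psi n p t = (1 + 2 * t) * (1 + t / (real n - 1) powr inv_exp p) ^ (n - 1)"

definition alpha_fun :: "real \<Rightarrow> real \<Rightarrow> real" where
  "alpha_fun a t = 2 / (1 - (a - 1) * t + sqrt ((1 - (a - 1) * t)\<^sup>2 - 4 * t))"

definition h_fun :: "real \<Rightarrow> real \<Rightarrow> real" where
  "h_fun a t = t * alpha_fun a t"

definition Omega :: "nat \<Rightarrow> ereal \<Rightarrow> real \<Rightarrow> real \<Rightarrow> real" where
  "Omega n p a t = Psi n p (h_fun a t)"

text \<open>a = (n-1)^(1/q), where 1/q = 1 - 1/p.\<close>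
definition a_param :: "nat \<Rightarrow> ereal \<Rightarrow> real" where
  "a_param n p = (real n - 1) powr (1 - inv_exp p)"

fun T_map :: "'a::field poly \<Rightarrow> nat \<Rightarrow> nat \<Rightarrow> (nat \<Rightarrow> 'a) \<Rightarrow> (nat \<Rightarrow> 'a)" where
  "T_map f n 0 x = x"
| "T_map f n (Suc N) x = (\<lambda>i. x i - poly f (x i) /
       (lead_coeff f * (\<Prod>j\<in>{..<n} - {i}. (x i - T_map f n N x j))))"

fun D_dom :: "'a::field poly \<Rightarrow> nat \<Rightarrow> nat \<Rightarrow> (nat \<Rightarrow> 'a) set" where
  "D_dom f n 0 = UNIV"
| "D_dom f n (Suc N) = {x \<in> D_dom f n N.
      \<forall>i<n. \<forall>j<n. i \<noteq> j \<longrightarrow> x i \<noteq> T_map f n N x j}"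

definition root_vector :: "'a::field poly \<Rightarrow> nat \<Rightarrow> (nat \<Rightarrow> 'a) \<Rightarrow> bool" where
  "root_vector f n \<xi> \<longleftrightarrow> (\<forall>z. poly f z = lead_coeff f * (\<Prod>i<n. (z - \<xi> i)))"

end

(*
  Let r be the list of roots of f and W_i the Weierstrass corrections. Lagrange interpolation of
  monic polynomials of degree n - 1 at the nodes x_i gives sum_j W_j / (x_j - z) = 1 for every root z.
  Estimating the terms shows that z lies within relative distance h (relative to d_i(x)) of some x_i;
  a variant of the identity that involves two roots shows that no disc contains two of them, so the
  roots can be matched with the x_i. The condition Omega < 2 is what keeps z away from the larger
  root of the quadratic equation satisfied by h.

  With E = ||(x - xi) / d(x)||_p, beta = (1 + E/(n-1)^(1/p))^(n-1) - 1 and rho = beta (1 + 2E),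
  the condition Psi(E) < 2 says rho < 1 - 2E. Induction on N gives
  |T^(N)_i(x) - xi_i| <= beta rho^(N-1) |x_i - xi_i|, and E does not increase along the iteration.
  As beta and rho are O(E), the order is N + 1.
*)

theory Submission
  imports Defs "HOL-Analysis.Convex"
begin

text \<open>Completeness of the field is not assumed, so \<open>\<xi>\<close> cannot be obtained as
  a limit of iterates: the roots exist by algebraic closedness, and convergence is contraction
  towards them. Simplicity of the zeros is a conclusion; until then the roots are an indexed family
  with possible repetitions, and the localization counts indices, not values. The quadratic comes
  from 1 <= t/u + a t/(1 - u) with u = |x_i - z| / d_i(x) and t = E_f(x), where a is the Hoelder
  constant for the n - 1 other nodes. The bound t <= 1/(1 + sqrt a)^2 makes its roots real. Omega <
  2 makes its value at 1/2 negative, so 1/2 lies strictly between the roots, while u >= 1/2 is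
  excluded by a cruder estimate. E_f of the later iterates is not controlled. The iteration
  therefore tracks the true error relative to d(x^(k)), and the error estimate at step k is obtained
  by localizing the roots afresh around x^(k) and recognizing the same root-vector.\<close>

section \<open>Convexity, AM-GM and Hoelder inequalities\<close>

text \<open>Convexity of the power: between 0 and s the graph lies below its chord. This pulls a
  factor of at most 1 out of a power, linearly.\<close>

lemma power_one_plus_scaled_le:
  fixes \<mu> s :: real
  assumes "0 \<le> \<mu>" "\<mu> \<le> 1" "0 \<le> s"
  shows "(1 + \<mu> * s) ^ m - 1 \<le> \<mu> * ((1 + s) ^ m - 1)"
proof (induction m)
  case (Suc m)
  define P where "P = (1 + s) ^ m"
  have P: "P \<ge> 1" using assms unfolding P_def by (intro one_le_power) auto
  have "(1 + \<mu> * s) ^ Suc m \<le> (1 + \<mu> * s) * (1 + \<mu> * (P - 1))"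
    using Suc.IH assms by (auto simp: P_def intro!: mult_left_mono)
  also have "\<dots> = 1 + \<mu> * (P - 1) + \<mu> * s + \<mu> * (\<mu> * (s * (P - 1)))"
    by (simp add: algebra_simps)
  also have "\<dots> \<le> 1 + \<mu> * (P - 1) + \<mu> * s + 1 * (\<mu> * (s * (P - 1)))"
    using assms P by (intro add_left_mono mult_right_mono) auto
  also have "\<dots> = 1 + \<mu> * ((1 + s) ^ Suc m - 1)"
    by (simp add: P_def algebra_simps)
  finally show ?case by simp
qed simp

lemma prod_one_plus_le:
  fixes u :: "'b \<Rightarrow> real"
  assumes "finite S" "S \<noteq> {}" "\<And>i. i \<in> S \<Longrightarrow> 0 \<le> u i"
  shows "(\<Prod>i\<in>S. 1 + u i) \<le> (1 + (\<Sum>i\<in>S. u i) / card S) ^ card S"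
proof -
  have c: "card S > 0" using assms by (simp add: card_gt_0_iff)
  have pos: "(\<Prod>i\<in>S. 1 + u i) > 0"
    using assms by (intro prod_pos) (auto simp: add_pos_nonneg)
  have "(\<Prod>i\<in>S. 1 + u i) powr (1 / card S) \<le> (\<Sum>i\<in>S. (1 + u i) / card S)"
    using assms by (intro arith_geom_mean) (auto simp: add_nonneg_nonneg)
  also have "\<dots> = 1 + (\<Sum>i\<in>S. u i) / card S"
    using c by (simp add: sum_divide_distrib [symmetric] sum.distrib add_divide_distrib)
  finally have "((\<Prod>i\<in>S. 1 + u i) powr (1 / card S)) ^ card S \<le> (1 + (\<Sum>i\<in>S. u i) / card S) ^ card S"
    by (intro power_mono) auto
  moreover have "((\<Prod>i\<in>S. 1 + u i) powr (1 / card S)) ^ card S = (\<Prod>i\<in>S. 1 + u i)"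
    using c pos by (subst powr_realpow [symmetric]) (auto simp: powr_powr)
  ultimately show ?thesis by simp
qed

text \<open>Hoelder against the constant vector 1, that is, the power mean inequality, from
  convexity of the r-th power.\<close>

lemma sum_le_card_powr_norm:
  fixes v :: "'b \<Rightarrow> real"
  assumes "finite S" "1 \<le> r" "\<And>i. i \<in> S \<Longrightarrow> 0 \<le> v i"
  shows "(\<Sum>i\<in>S. v i) \<le> card S powr (1 - 1 / r) * (\<Sum>i\<in>S. v i powr r) powr (1 / r)"
proof -
  \<comment> \<open>Jensen is applied to the positive entries only. Replacing the number of these by
    \<open>card S\<close> at the end is harmless because \<open>1 - 1 / r\<close> is
    nonnegative.\<close>
  define P where "P = {i\<in>S. 0 < v i}"
  have fin: "finite P" "P \<subseteq> S" using assms by (auto simp: P_def)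
  have sP: "(\<Sum>i\<in>S. v i) = (\<Sum>i\<in>P. v i)" "(\<Sum>i\<in>S. v i powr r) = (\<Sum>i\<in>P. v i powr r)"
    using assms by (auto simp: P_def intro!: sum.mono_neutral_right) (force simp: not_less)+
  show ?thesis
  proof (cases "P = {}")
    case True
    then show ?thesis using sP by simp
  next
    case False
    define m where "m = real (card P)"
    define Z where "Z = (\<Sum>i\<in>P. v i powr r)"
    have m: "m > 0" using fin False by (simp add: m_def card_gt_0_iff)
    have Z: "Z \<ge> 0" by (simp add: Z_def sum_nonneg)
    have s: "(\<Sum>i\<in>P. v i) > 0" using fin False by (intro sum_pos) (auto simp: P_def)
    have "(\<Sum>i\<in>P. (1 / m) *\<^sub>R v i) powr r \<le> (\<Sum>i\<in>P. (1 / m) * (v i powr r))"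
      using fin False m
      by (intro convex_on_sum [OF _ _ powr_convex [OF \<open>1 \<le> r\<close>]]) (auto simp: P_def m_def)
    then have "((\<Sum>i\<in>P. v i) / m) powr r \<le> Z / m"
      by (simp add: sum_divide_distrib Z_def)
    then have "(((\<Sum>i\<in>P. v i) / m) powr r) powr (1 / r) \<le> (Z / m) powr (1 / r)"
      using assms by (intro powr_mono2) auto
    then have "(\<Sum>i\<in>P. v i) / m \<le> (Z / m) powr (1 / r)"
      using assms s m by (simp add: powr_powr)
    then have "(\<Sum>i\<in>P. v i) \<le> m * (Z / m) powr (1 / r)"
      using m by (simp add: field_simps)
    also have "\<dots> = m powr (1 - 1 / r) * Z powr (1 / r)"
      using m Z by (simp add: powr_divide powr_diff)
    also have "\<dots> \<le> card S powr (1 - 1 / r) * Z powr (1 / r)"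
      using assms fin m by (intro mult_right_mono powr_mono2) (auto simp: m_def card_mono)
    finally show ?thesis by (simp add: sP Z_def)
  qed
qed

section \<open>The p-norm and the constant a\<close>

lemma inv_exp_bounds:
  assumes "1 \<le> p"
  shows "0 \<le> inv_exp p" "inv_exp p \<le> 1"
  using assms by (cases p; auto simp: inv_exp_def one_ereal_def)+

lemma pnorm_infinity: "pnorm \<infinity> n v = Max ((\<lambda>i. \<bar>v i\<bar>) ` {..<n})"
  by (simp add: pnorm_def)

lemma pnorm_ereal: "pnorm (ereal r) n v = (\<Sum>i<n. \<bar>v i\<bar> powr r) powr (1 / r)"
  by (simp add: pnorm_def)

lemma abs_le_pnorm:
  assumes "1 \<le> p" "i < n"
  shows "\<bar>v i\<bar> \<le> pnorm p n v"
proof (cases p)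
  case (real r)
  then have r: "1 \<le> r" using assms by (simp add: one_ereal_def)
  have "\<bar>v i\<bar> = (\<bar>v i\<bar> powr r) powr (1 / r)" using r by (simp add: powr_powr)
  also have "\<dots> \<le> (\<Sum>i<n. \<bar>v i\<bar> powr r) powr (1 / r)"
    using r assms by (intro powr_mono2 member_le_sum) auto
  finally show ?thesis by (simp add: real pnorm_ereal)
qed (use assms in \<open>auto simp: pnorm_infinity intro!: Max_ge\<close>)

lemma pnorm_nonneg:
  assumes "1 \<le> p" "0 < n"
  shows "0 \<le> pnorm p n v"
  using abs_le_pnorm [OF assms, of v] by linarith

lemma pnorm_mono:
  assumes "1 \<le> p" "0 < n" "\<And>i. i < n \<Longrightarrow> \<bar>v i\<bar> \<le> \<bar>w i\<bar>"
  shows "pnorm p n v \<le> pnorm p n w"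
proof (cases p)
  case (real r)
  then have "1 \<le> r" using assms by (simp add: one_ereal_def)
  then show ?thesis unfolding real pnorm_ereal using assms
    by (intro powr_mono2 sum_mono sum_nonneg) auto
next
  case PInf
  have "\<bar>v i\<bar> \<le> Max ((\<lambda>i. \<bar>w i\<bar>) ` {..<n})" if "i < n" for i
    using assms that by (intro order_trans [OF assms(3) Max_ge]) auto
  then show ?thesis using assms unfolding PInf pnorm_infinity by (subst Max_le_iff) auto
qed (use assms in auto)

lemma pnorm_cmult:
  assumes "1 \<le> p" "0 < n" "0 \<le> c"
  shows "pnorm p n (\<lambda>i. c * v i) = c * pnorm p n v"
proof (cases p)
  case (real r)
  then have "1 \<le> r" using assms by (simp add: one_ereal_def)
  then show ?thesis unfolding real pnorm_ereal using assms
    by (simp add: abs_mult powr_mult sum_distrib_left [symmetric] powr_powr sum_nonneg)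
next
  case PInf
  have "Max ((\<lambda>i. \<bar>c * v i\<bar>) ` {..<n}) = Max ((\<lambda>x. c * x) ` (\<lambda>i. \<bar>v i\<bar>) ` {..<n})"
    using assms by (simp add: image_image abs_mult)
  also have "\<dots> = c * Max ((\<lambda>i. \<bar>v i\<bar>) ` {..<n})"
    using assms by (subst mono_Max_commute [symmetric]) (auto simp: mono_def mult_left_mono)
  finally show ?thesis by (simp add: PInf pnorm_infinity)
qed (use assms in auto)

lemma a_param_ge_1:
  assumes "1 \<le> p" "2 \<le> n"
  shows "1 \<le> a_param n p"
  using assms inv_exp_bounds [of p] unfolding a_param_def by (intro ge_one_powr_ge_zero) auto

text \<open>The relation 1/p + 1/q = 1 in exponent form. It converts the quotient a / (n - 1), left
  by AM-GM and Hoelder, into the denominator found in \<open>Psi\<close>.\<close>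

lemma a_param_times_powr:
  assumes "1 \<le> p" "2 \<le> n"
  shows "a_param n p * (real n - 1) powr inv_exp p = real n - 1"
  using assms unfolding a_param_def by (simp add: powr_add [symmetric])

text \<open>Hoelder for n - 1 terms, which is the origin of \<open>a_param\<close>; restoring the
  entry i can only enlarge the norm.\<close>

lemma sum_except_le_pnorm:
  assumes "1 \<le> p" "2 \<le> n" "i < n" "\<And>j. j < n \<Longrightarrow> 0 \<le> v j"
  shows "(\<Sum>j\<in>{..<n} - {i}. v j) \<le> a_param n p * pnorm p n v"
proof (cases p)
  case (real r)
  then have r: "1 \<le> r" using assms by (simp add: one_ereal_def)
  have "(\<Sum>j\<in>{..<n} - {i}. v j)
      \<le> card ({..<n} - {i}) powr (1 - 1 / r) * (\<Sum>j\<in>{..<n} - {i}. v j powr r) powr (1 / r)"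
    using assms r by (intro sum_le_card_powr_norm) auto
  also have "\<dots> \<le> card ({..<n} - {i}) powr (1 - 1 / r) * (\<Sum>j<n. \<bar>v j\<bar> powr r) powr (1 / r)"
  proof (intro mult_left_mono powr_mono2)
    have "(\<Sum>j\<in>{..<n} - {i}. v j powr r) = (\<Sum>j\<in>{..<n} - {i}. \<bar>v j\<bar> powr r)"
      using assms by (intro sum.cong) auto
    also have "\<dots> \<le> (\<Sum>j<n. \<bar>v j\<bar> powr r)"
      by (intro sum_mono2) auto
    finally show "(\<Sum>j\<in>{..<n} - {i}. v j powr r) \<le> (\<Sum>j<n. \<bar>v j\<bar> powr r)" .
  qed (use r in \<open>auto intro!: sum_nonneg\<close>)
  finally show ?thesis
    using assms by (simp add: real pnorm_ereal a_param_def inv_exp_def of_nat_diff)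
next
  case PInf
  have "(\<Sum>j\<in>{..<n} - {i}. v j) \<le> (\<Sum>j\<in>{..<n} - {i}. pnorm p n v)"
    using abs_le_pnorm [OF assms(1), of _ n v] by (intro sum_mono) (metis DiffD1 abs_ge_self lessThan_iff order_trans)
  then show ?thesis
    using assms PInf by (simp add: a_param_def inv_exp_def of_nat_diff)
qed (use assms in auto)

text \<open>AM-GM replaces the factors by their mean, and Hoelder bounds the mean. The second factor
  of \<open>Psi\<close> arises here.\<close>

lemma prod_except_le_pnorm:
  assumes "1 \<le> p" "2 \<le> n" "i < n" "\<And>j. j < n \<Longrightarrow> 0 \<le> v j"
  shows "(\<Prod>j\<in>{..<n} - {i}. 1 + v j)
    \<le> (1 + pnorm p n v / (real n - 1) powr inv_exp p) ^ (n - 1)"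
proof -
  define b where "b = (real n - 1) powr inv_exp p"
  have b: "b > 0" "a_param n p * b = real n - 1"
    using assms a_param_times_powr [of p n] by (auto simp: b_def)
  have c: "card ({..<n} - {i}) = n - 1" "{..<n} - {i} \<noteq> {}"
  proof -
    show c: "card ({..<n} - {i}) = n - 1" using assms by auto
    show "{..<n} - {i} \<noteq> {}"
    proof
      assume "{..<n} - {i} = {}"
      with c have "n - 1 = 0" by (simp only: card.empty)
      then show False using assms(2) by simp
    qed
  qed
  have "(\<Prod>j\<in>{..<n} - {i}. 1 + v j) \<le> (1 + (\<Sum>j\<in>{..<n} - {i}. v j) / (n - 1)) ^ (n - 1)"
    using prod_one_plus_le [of "{..<n} - {i}" v] c assms by auto
  also have "\<dots> \<le> (1 + pnorm p n v / b) ^ (n - 1)"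
  proof (intro power_mono add_left_mono)
    have "(\<Sum>j\<in>{..<n} - {i}. v j) / (real n - 1) \<le> a_param n p * pnorm p n v / (real n - 1)"
      using assms by (intro divide_right_mono sum_except_le_pnorm) auto
    also have "\<dots> = pnorm p n v / b"
      using b(1) assms by (simp add: b(2) [symmetric] field_simps) (use b a_param_ge_1[of p n] in auto)
    finally show "(\<Sum>j\<in>{..<n} - {i}. v j) / real (n - 1) \<le> pnorm p n v / b"
      using assms by (simp add: of_nat_diff)
    show "0 \<le> 1 + (\<Sum>j\<in>{..<n} - {i}. v j) / real (n - 1)"
      using assms by (intro add_nonneg_nonneg divide_nonneg_nonneg sum_nonneg) auto
  qed
  finally show ?thesis by (simp add: b_def)
qed

section \<open>Lagrange interpolation and splitting into linear factors\<close>

lemma prod_linear_poly: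
  fixes r :: "'b \<Rightarrow> 'a::field"
  shows "degree (\<Prod>m\<in>T. [:- r m, 1:]) = card T" "lead_coeff (\<Prod>m\<in>T. [:- r m, 1:]) = 1"
    "poly (\<Prod>m\<in>T. [:- r m, 1:]) z = (\<Prod>m\<in>T. z - r m)"
proof -
  show "degree (\<Prod>m\<in>T. [:- r m, 1:]) = card T"
    by (subst degree_prod_eq_sum_degree) auto
  show "lead_coeff (\<Prod>m\<in>T. [:- r m, 1:]) = 1"
    unfolding lead_coeff_prod by simp
qed (simp add: poly_prod)

text \<open>The monic product \<open>G\<close> over \<open>T\<close> has degree below
  \<open>card S\<close>, so it equals its interpolation polynomial \<open>L\<close>. Every basis
  product \<open>B j\<close> is monic of degree \<open>card T\<close>; comparing the coefficients of
  that degree gives the identity. Repeated values of \<open>r\<close> are allowed.\<close>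

lemma lagrange_monic_sum:
  fixes x :: "'b \<Rightarrow> 'a::field" and r :: "'c \<Rightarrow> 'a"
  assumes "finite S" "inj_on x S" "finite T" "card S = Suc (card T)"
  shows "(\<Sum>j\<in>S. (\<Prod>m\<in>T. x j - r m) / (\<Prod>m\<in>S - {j}. x j - x m)) = 1"
proof -
  define G where "G = (\<Prod>m\<in>T. [:- r m, 1:])"
  define c where "c j = (\<Prod>m\<in>T. x j - r m) / (\<Prod>m\<in>S - {j}. x j - x m)" for j
  define B where "B j = (\<Prod>m\<in>S - {j}. [:- x m, 1:])" for j
  define L where "L = (\<Sum>j\<in>S. smult (c j) (B j))"
  have degB: "degree (B j) = card T" and coeffB: "coeff (B j) (card T) = 1" if "j \<in> S" for j
    using assms that prod_linear_poly(1,2) [of x "S - {j}"] by (auto simp: B_def)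
  have pB: "poly (B j) z = (\<Prod>m\<in>S - {j}. z - x m)" for j z
    using assms by (simp add: B_def prod_linear_poly)
  have degL: "degree L \<le> card T"
    unfolding L_def using assms degB by (intro degree_sum_le) (auto intro: order_trans [OF degree_smult_le])
  have "G = L"
  proof (rule poly_eqI_degree [of "x ` S"])
    fix z assume "z \<in> x ` S"
    then obtain j where j: "j \<in> S" "z = x j" by auto
    have nz: "(\<Prod>m\<in>S - {j}. x j - x m) \<noteq> 0"
      using assms j by (auto simp: inj_on_def)
    have "poly (B m) z = 0" if "m \<in> S" "m \<noteq> j" for m
      using j assms that by (auto simp: pB)
    then have "poly L z = c j * poly (B j) z"
      using assms j unfolding L_def poly_sum by (subst sum.remove [of _ j]) auto
    then show "poly G z = poly L z"
      using nz assms j by (simp add: c_def pB G_def prod_linear_poly)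
  qed (use assms degL prod_linear_poly(1) [of r T] in \<open>auto simp: card_image G_def\<close>)
  have "coeff G (card T) = 1"
    using assms prod_linear_poly(1,2) [of r T] by (simp add: G_def)
  moreover have "coeff L (card T) = (\<Sum>j\<in>S. c j)"
    using coeffB by (simp add: L_def coeff_sum)
  ultimately show ?thesis using \<open>G = L\<close> by (simp add: c_def)
qed

lemma alg_closed_field_factorization:
  fixes f :: "'a::field poly"
  assumes "alg_closed_field TYPE('a)" "f \<noteq> 0"
  shows "\<exists>r. f = smult (lead_coeff f) (\<Prod>i<degree f. [:- r i, 1:])"
  using assms(2)
proof (induction "degree f" arbitrary: f)
  case 0
  then show ?case by (auto elim!: degree_eq_zeroE)
next
  case (Suc d)
  obtain z where "poly f z = 0"
    using assms(1) Suc.hyps(2) unfolding alg_closed_field_def by (metis zero_less_Suc)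
  then obtain g where g: "f = [:- z, 1:] * g"
    unfolding poly_eq_0_iff_dvd by (elim dvdE)
  with Suc.prems have "g \<noteq> 0" by auto
  then have d: "degree g = d"
    using Suc.hyps(2) unfolding g by (simp add: degree_mult_eq del: mult_pCons_left)
  have lc: "lead_coeff f = lead_coeff g"
    unfolding g lead_coeff_mult by simp
  obtain r where r: "g = smult (lead_coeff g) (\<Prod>i<degree g. [:- r i, 1:])"
    using Suc.hyps(1) [of g] d \<open>g \<noteq> 0\<close> by auto
  have "(\<Prod>i<Suc d. [:- (r(d := z)) i, 1:]) = (\<Prod>i<d. [:- r i, 1:]) * [:- z, 1:]"
  proof -
    have "(\<Prod>i<d. [:- (r(d := z)) i, 1:]) = (\<Prod>i<d. [:- r i, 1:])"
      by (intro prod.cong) auto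
    then show ?thesis unfolding prod.lessThan_Suc by (simp only: fun_upd_same)
  qed
  then have "f = smult (lead_coeff f) (\<Prod>i<degree f. [:- (r(d := z)) i, 1:])"
    using g r d lc Suc.hyps(2) by (metis mult.commute mult_smult_right)
  then show ?case by blast
qed

text \<open>The cofactor \<open>g\<close> of the linear factor that vanishes at z does not vanish
  there, since the \<open>\<xi> i\<close> are distinct.\<close>

lemma order_prod_distinct_linear:
  fixes \<xi> :: "nat \<Rightarrow> 'a::field"
  assumes f: "f = smult c (\<Prod>i<n. [:- \<xi> i, 1:])" "c \<noteq> 0"
    and "inj_on \<xi> {..<n}" "poly f z = 0"
  shows "order z f = 1"
proof -
  obtain i where i: "i < n" "z = \<xi> i"
    using assms by (auto simp: poly_prod)
  define g where "g = (\<Prod>j\<in>{..<n} - {i}. [:- \<xi> j, 1:])"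
  have "poly g z \<noteq> 0"
    using assms i by (auto simp: g_def poly_prod inj_on_def)
  moreover have fg: "f = smult c ([:- z, 1:] * g)"
    unfolding f g_def i(2) using i by (subst prod.remove [of _ i]) auto
  moreover from \<open>poly g z \<noteq> 0\<close> have "g \<noteq> 0" by auto
  then have "[:- z, 1:] * g \<noteq> 0" by (simp only: mult_eq_0_iff) simp
  ultimately have "order z f = order z [:- z, 1:] + order z g"
    using f(2) by (metis order_smult order_mult)
  then show ?thesis
    using order_power_n_n [of z 1] \<open>poly g z \<noteq> 0\<close> by (simp add: order_0I)
qed

section \<open>Arithmetic of an absolute value and the distances d_i\<close>

locale absval =
  fixes av :: "'a::field \<Rightarrow> real"
  assumes absval: "is_absval av"
begin

lemma av_nonneg [simp]: "0 \<le> av x"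
  and av_eq_0_iff [simp]: "av x = 0 \<longleftrightarrow> x = 0"
  and av_mult: "av (x * y) = av x * av y"
  and av_triangle: "av (x + y) \<le> av x + av y"
  using absval by (auto simp: is_absval_def)

lemma av_0 [simp]: "av 0 = 0" by simp

lemma av_pos_iff [simp]: "0 < av x \<longleftrightarrow> x \<noteq> 0"
  using av_nonneg [of x] av_eq_0_iff [of x] by linarith

lemma av_1 [simp]: "av 1 = 1"
  using av_mult [of 1 1] av_eq_0_iff [of 1] by simp

lemma av_minus [simp]: "av (- x) = av x"
proof -
  have "av (- 1) * av (- 1) = 1" using av_mult [of "- 1" "- 1"] by simp
  then have "av (- 1) = 1"
    using av_nonneg [of "- 1"] by (metis abs_of_nonneg power2_eq_square power2_eq_1_iff abs_1 abs_minus_cancel)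
  then show ?thesis using av_mult [of "- 1" x] by simp
qed

lemma av_commute: "av (x - y) = av (y - x)"
  using av_minus [of "x - y"] by simp

lemma av_diff_triangle: "av (x - z) \<le> av (x - y) + av (y - z)"
  using av_triangle [of "x - y" "y - z"] by simp

lemma av_divide: "av (x / y) = av x / av y"
proof (cases "y = 0")
  case False
  then show ?thesis using av_mult [of "x / y" y] by (simp add: field_simps)
qed simp

lemma av_sum: "av (sum g S) \<le> (\<Sum>i\<in>S. av (g i))"
proof (induction S rule: infinite_finite_induct)
  case (insert i S)
  then show ?case using av_triangle [of "g i" "sum g S"] by simp
qed auto

text \<open>After expansion, each nonconstant monomial in the \<open>u i\<close> is bounded by the
  same monomial in the \<open>av (u i)\<close>.\<close>

lemma av_prod_one_plus_diff:
  assumes "finite S"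
  shows "av (1 - (\<Prod>i\<in>S. 1 + u i)) \<le> (\<Prod>i\<in>S. 1 + av (u i)) - 1"
  using assms
proof induction
  case (insert i S)
  define P where "P = (\<Prod>i\<in>S. 1 + u i)"
  define Q where "Q = (\<Prod>i\<in>S. 1 + av (u i))"
  have IH: "av (1 - P) \<le> Q - 1" using insert.IH by (simp add: P_def Q_def)
  have "av P \<le> Q" using av_triangle [of 1 "P - 1"] av_commute [of 1 P] IH by simp
  then have "av (u i * P) \<le> av (u i) * Q" by (simp add: av_mult mult_left_mono)
  moreover have "1 - (1 + u i) * P = (1 - P) + - (u i * P)" by (simp add: algebra_simps)
  ultimately have "av (1 - (1 + u i) * P) \<le> (1 + av (u i)) * Q - 1"
    using av_triangle [of "1 - P" "- (u i * P)"] IH by (simp add: algebra_simps)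
  then show ?case using insert.hyps by (simp add: P_def Q_def)
qed simp

lemma dmin_le: "\<lbrakk>i < n; j < n; i \<noteq> j\<rbrakk> \<Longrightarrow> dmin av n x i \<le> av (x i - x j)"
  unfolding dmin_def by (intro Min_le) auto

lemma dmin_le': "\<lbrakk>i < n; j < n; i \<noteq> j\<rbrakk> \<Longrightarrow> dmin av n x j \<le> av (x i - x j)"
  using dmin_le [of j n i x] by (simp add: av_commute)

lemma other_index: "2 \<le> n \<Longrightarrow> \<exists>j<n. j \<noteq> (i::nat)"
  by (rule exI [of _ "if i = 0 then 1 else 0"]) auto

lemma le_dmin:
  assumes "2 \<le> n" "\<And>j. \<lbrakk>j < n; j \<noteq> i\<rbrakk> \<Longrightarrow> c \<le> av (x i - x j)"
  shows "c \<le> dmin av n x i"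
  unfolding dmin_def using assms other_index [of n i] by (subst Min_ge_iff) auto

lemma dmin_pos:
  assumes "2 \<le> n" "i < n" "inj_on x {..<n}"
  shows "0 < dmin av n x i"
  unfolding dmin_def using assms other_index [of n i]
  by (subst Min_gr_iff) (auto simp: inj_on_def)

end

section \<open>The quadratic equation for the disc radius\<close>

text \<open>\<open>1 / \<alpha>\<close> is the larger root of the quadratic; the roots have product
  \<open>t\<close>, so \<open>h = t * \<alpha>\<close> is the smaller one. The last identity says
  that 1 - a t/(1 - h), the factor occurring in the a posteriori bound, is
  \<open>1 / \<alpha>\<close>.\<close>

lemma h_fun_props:
  fixes a t :: real
  defines "h \<equiv> h_fun a t" and "\<alpha> \<equiv> alpha_fun a t"
  assumes a: "1 \<le> a" and t: "0 \<le> t" "t \<le> 1 / (1 + sqrt a)\<^sup>2"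
  shows "0 < \<alpha>" "0 \<le> h" "h = t * \<alpha>" "h\<^sup>2 - (1 - (a - 1) * t) * h + t = 0"
    "\<alpha> * (1 - h - a * t) = 1 - h"
proof -
  define B where "B = 1 - (a - 1) * t"
  define R where "R = sqrt (B\<^sup>2 - 4 * t)"
  \<comment> \<open>The hypothesis rearranges to sqrt (a t) <= 1 - sqrt t; squaring gives B >= 2
    sqrt t, hence a nonnegative discriminant.\<close>
  have "sqrt t \<le> 1 / (1 + sqrt a)"
    using real_sqrt_le_mono [OF t(2)] a by (simp add: real_sqrt_divide)
  then have "sqrt t * (1 + sqrt a) \<le> 1"
    using a by (simp add: field_simps add_pos_nonneg)
  then have "sqrt t * sqrt a \<le> 1 - sqrt t" by (simp add: algebra_simps)
  then have "(sqrt t * sqrt a)\<^sup>2 \<le> (1 - sqrt t)\<^sup>2" using t a by (intro power_mono) auto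
  then have B: "2 * sqrt t \<le> B"
    using t a by (simp add: power_mult_distrib power2_diff B_def algebra_simps)
  have "(2 * sqrt t)\<^sup>2 \<le> B\<^sup>2" using B t by (intro power_mono) auto
  then have disc: "0 \<le> B\<^sup>2 - 4 * t" using t by (simp add: power_mult_distrib)
  have "0 < B"
  proof (cases "t = 0")
    case False
    then have "0 < sqrt t" using t by simp
    then show ?thesis using B by linarith
  qed (simp add: B_def)
  moreover have "0 \<le> R" using disc by (simp add: R_def)
  ultimately have S: "0 < B + R" by simp
  have \<alpha>: "\<alpha> = 2 / (B + R)" by (simp add: \<alpha>_def alpha_fun_def B_def R_def)
  show "0 < \<alpha>" using S \<alpha> by simp
  show "h = t * \<alpha>" by (simp add: h_def h_fun_def \<alpha>_def)
  then show "0 \<le> h" using t \<open>0 < \<alpha>\<close> by simp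
  have "R\<^sup>2 = B\<^sup>2 - 4 * t" using disc by (simp add: R_def)
  then have "t = (B - R) / 2 * ((B + R) / 2)" by (simp add: power2_eq_square algebra_simps)
  moreover have inv: "(B + R) / 2 * \<alpha> = 1" using S by (simp add: \<alpha>)
  ultimately have "h = (B - R) / 2" unfolding \<open>h = t * \<alpha>\<close> by (metis mult.assoc mult.right_neutral)
  then have "h\<^sup>2 - B * h = (R\<^sup>2 - B\<^sup>2) / 4"
    by (simp only:) (simp add: power2_eq_square field_simps)
  then show "h\<^sup>2 - (1 - (a - 1) * t) * h + t = 0"
    unfolding \<open>R\<^sup>2 = B\<^sup>2 - 4 * t\<close> by (simp add: B_def)
  have "1 - h - a * t = (B + R) / 2 - t" unfolding \<open>h = (B - R) / 2\<close> by (simp add: B_def field_simps)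
  then have "\<alpha> * (1 - h - a * t) = (B + R) / 2 * \<alpha> - t * \<alpha>"
    by (simp only: mult.commute [of \<alpha>] left_diff_distrib)
  then show "\<alpha> * (1 - h - a * t) = 1 - h" unfolding \<open>h = t * \<alpha>\<close> using inv by simp
qed

text \<open>Bernoulli bounds \<open>Psi n p h\<close> from below by (1 + 2h)(1 + a h); expanding
  this product gives a condition on h and a without an n-th power.\<close>

lemma Psi_less_2_imp:
  assumes "1 \<le> p" "2 \<le> n" "0 \<le> h" "Psi n p h < 2"
  shows "h < 1 / 2" "(a_param n p + 2) * h + 2 * a_param n p * h\<^sup>2 < 1"
proof -
  define b where "b = (real n - 1) powr inv_exp p"
  have b: "0 < b" "a_param n p * b = real n - 1"
    using assms a_param_times_powr [of p n] by (auto simp: b_def)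
  have "1 + real (n - 1) * (h / b) \<le> (1 + h / b) ^ (n - 1)"
    using assms b by (intro Bernoulli_inequality) (auto intro: order_trans [of _ 0])
  moreover have "real (n - 1) * (h / b) = a_param n p * h"
    using assms b by (simp add: of_nat_diff b(2) [symmetric])
  ultimately have "(1 + 2 * h) * (1 + a_param n p * h) \<le> Psi n p h"
    unfolding Psi_def b_def using assms by (intro mult_left_mono) auto
  then show *: "(a_param n p + 2) * h + 2 * a_param n p * h\<^sup>2 < 1"
    using assms by (simp add: algebra_simps power2_eq_square)
  have "0 \<le> a_param n p * h" "0 \<le> a_param n p * h\<^sup>2"
    using assms a_param_ge_1 [of p n] by auto
  then show "h < 1 / 2" using * by (simp add: algebra_simps)
qed

text \<open>The first bound makes the quadratic negative at 1/2, where its value is (2(a + 1)t -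
  1)/4; the second prevents two roots from sharing a disc. Both are obtained by eliminating t
  through \<open>t * D = h * (1 - h)\<close>, which is the quadratic rewritten.\<close>

lemma disc_radius_bounds:
  fixes a t h :: real
  assumes a: "1 \<le> a" and h: "0 \<le> h" and q: "h\<^sup>2 - (1 - (a - 1) * t) * h + t = 0"
    and small: "(a + 2) * h + 2 * a * h\<^sup>2 < 1"
  shows "2 * (a + 1) * t < 1" "a * t < (1 - h)\<^sup>2"
proof -
  have ah: "0 \<le> a * h" "0 \<le> a * h\<^sup>2" using a h by auto
  have h2: "h < 1 / 2" using small ah by (simp add: algebra_simps)
  define D where "D = 1 + (a - 1) * h"
  have D: "1 \<le> D" using a h by (simp add: D_def)
  have tD: "t * D = h * (1 - h)" using q by (simp add: D_def algebra_simps power2_eq_square)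
  \<comment> \<open>The first claim after eliminating t. Its left side exceeds that of
    \<open>small\<close> by h - (4a + 2)h^2, and the cases are the two signs of this
    difference.\<close>
  have "(a + 3) * h - (2 * a + 2) * h\<^sup>2 < 1"
  proof (cases "h * (4 * a + 2) \<ge> 1")
    case True
    then have "h * 1 \<le> h * (h * (4 * a + 2))" using h by (intro mult_left_mono) auto
    then show ?thesis using small by (simp add: algebra_simps power2_eq_square)
  next
    case False
    then have "h * (4 * a + 2) < 1" by simp
    moreover have "(a + 3) * h \<le> h * (4 * a + 2)" using mult_right_mono [OF a h] h by (simp add: algebra_simps)
    ultimately have "(a + 3) * h < 1" by linarith
    moreover have "0 \<le> (2 * a + 2) * h\<^sup>2" using a by simp
    ultimately show ?thesis by linarith
  qed
  then have "2 * (a + 1) * (t * D) < D" unfolding tD by (simp add: D_def algebra_simps power2_eq_square)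
  then have "2 * (a + 1) * t * D < 1 * D" by (simp add: mult.assoc)
  then show "2 * (a + 1) * t < 1" using D mult_less_cancel_right_pos [of D] by auto
  have "(a - 1) * h\<^sup>2 + 2 * h < 1"
    using small ah h mult_right_mono [OF a h] by (simp add: algebra_simps)
       (use zero_le_power2 [of h] in linarith)
  then have "a * h < (1 - h) * D" by (simp add: D_def algebra_simps power2_eq_square)
  then have "(a * h) * (1 - h) < (1 - h) * D * (1 - h)" using h2 by (intro mult_strict_right_mono) auto
  moreover have "(a * t) * D = (a * h) * (1 - h)" using tD by (metis mult.assoc)
  moreover have "(1 - h) * D * (1 - h) = (1 - h)\<^sup>2 * D" by (simp add: power2_eq_square mult_ac)
  ultimately have "(a * t) * D < (1 - h)\<^sup>2 * D" by linarith
  then show "a * t < (1 - h)\<^sup>2" using D mult_less_cancel_right_pos [of D] by auto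
qed

section \<open>Localization of the roots by the Weierstrass corrections\<close>

lemma weierstrass_sum_at_root:
  fixes x r :: "nat \<Rightarrow> 'a::field"
  assumes "inj_on x {..<n}" "k < n" "\<And>j. j < n \<Longrightarrow> x j \<noteq> r k"
  shows "(\<Sum>j<n. (\<Prod>m<n. x j - r m) / (\<Prod>m\<in>{..<n} - {j}. x j - x m) / (x j - r k)) = 1"
proof -
  have "(\<Sum>j<n. (\<Prod>m<n. x j - r m) / (\<Prod>m\<in>{..<n} - {j}. x j - x m) / (x j - r k))
      = (\<Sum>j<n. (\<Prod>m\<in>{..<n} - {k}. x j - r m) / (\<Prod>m\<in>{..<n} - {j}. x j - x m))"
    using assms by (intro sum.cong refl, subst prod.remove [of _ k]) auto
  also have "\<dots> = 1" using assms by (intro lagrange_monic_sum) auto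
  finally show ?thesis .
qed

context absval
begin

text \<open>The node nearest to the root works. Its relative distance \<open>u\<close> satisfies the
  quadratic inequality, so it is at most \<open>h\<close> or at least the larger root; a cruder use
  of the same identity gives u < 1/2 and rules out the latter.\<close>

lemma root_in_disc:
  fixes x r :: "nat \<Rightarrow> 'a" and a t h :: real and n :: nat
  defines "W \<equiv> \<lambda>j. (\<Prod>m<n. x j - r m) / (\<Prod>m\<in>{..<n} - {j}. x j - x m)"
  assumes n: "2 \<le> n" and inj: "inj_on x {..<n}" and k: "k < n"
    and sumW: "\<And>i. i < n \<Longrightarrow> (\<Sum>j\<in>{..<n} - {i}. av (W j) / dmin av n x j) \<le> a * t"
    and W: "\<And>i. i < n \<Longrightarrow> av (W i) / dmin av n x i \<le> t"
    and h: "0 \<le> h" "h < 1 / 2" "h\<^sup>2 - (1 - (a - 1) * t) * h + t = 0"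
    and small: "2 * (a + 1) * t < 1"
  shows "\<exists>i<n. av (x i - r k) \<le> h * dmin av n x i"
proof (cases "\<exists>i<n. x i = r k")
  case True
  then show ?thesis using dmin_pos [OF n _ inj] h(1) by (metis av_0 diff_self less_imp_le mult_nonneg_nonneg)
next
  case False
  have d: "0 < dmin av n x i" if "i < n" for i using dmin_pos n inj that by blast
  define z where "z = r k"
  have nz: "x j - z \<noteq> 0" if "j < n" for j using False that by (auto simp: z_def)
  have "(\<Sum>j<n. W j / (x j - z)) = 1"
    unfolding W_def z_def using inj k nz by (intro weierstrass_sum_at_root) (auto simp: z_def)
  then have "1 = av (\<Sum>j<n. W j / (x j - z))" by simp
  also have "\<dots> \<le> (\<Sum>j<n. av (W j) / av (x j - z))"
    using av_sum [of "\<lambda>j. W j / (x j - z)" "{..<n}"] by (simp add: av_divide)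
  finally have one: "1 \<le> (\<Sum>j<n. av (W j) / av (x j - z))" .
  obtain i where i: "i < n" and near: "\<And>j. j < n \<Longrightarrow> av (x i - z) \<le> av (x j - z)"
    using ex_min_if_finite [of "(\<lambda>j. av (x j - z)) ` {..<n}"] k by (auto simp: not_less)
  define u where "u = av (x i - z) / dmin av n x i"
  have u: "0 < u" and xu: "av (x i - z) = u * dmin av n x i"
    using d [OF i] nz [OF i] by (auto simp: u_def)
  \<comment> \<open>Otherwise d_j <= 2|x_j - z| for all j: for j different from i, because d_j <=
    |x_i - x_j| and x_i is nearest to z. The identity would then give 1 <= 2(a + 1)t.\<close>
  have "u < 1 / 2"
  proof (rule ccontr)
    assume "\<not> u < 1 / 2"
    then have half: "dmin av n x i \<le> 2 * av (x i - z)"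
      using d [OF i] by (simp add: u_def field_simps)
    have "av (W j) / av (x j - z) \<le> 2 * (av (W j) / dmin av n x j)" if "j < n" for j
    proof -
      have "dmin av n x j \<le> 2 * av (x j - z)"
      proof (cases "j = i")
        case False
        have "dmin av n x j \<le> av (x i - x j)" using dmin_le' i that False by metis
        also have "\<dots> \<le> av (x i - z) + av (x j - z)"
          using av_diff_triangle [of "x i" "x j" z] av_commute [of z "x j"] by simp
        finally show ?thesis using near [OF that] by simp
      qed (use half in simp)
      then have "av (W j) * dmin av n x j \<le> av (W j) * (2 * av (x j - z))"
        by (intro mult_left_mono) auto
      then show ?thesis using d [OF that] nz [OF that] by (simp add: field_simps)
    qed
    then have "(\<Sum>j<n. av (W j) / av (x j - z)) \<le> (\<Sum>j<n. 2 * (av (W j) / dmin av n x j))"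
      by (intro sum_mono) auto
    also have "\<dots> = 2 * (av (W i) / dmin av n x i + (\<Sum>j\<in>{..<n} - {i}. av (W j) / dmin av n x j))"
      unfolding sum_distrib_left [symmetric] using i by (subst sum.remove [of _ i]) auto
    also have "\<dots> \<le> 2 * (a + 1) * t" using W [OF i] sumW [OF i] by (simp add: algebra_simps)
    finally show False using one small by simp
  qed
  have "av (W j) / av (x j - z) \<le> av (W j) / dmin av n x j / (1 - u)" if "j < n" "j \<noteq> i" for j
  proof -
    have "(1 - u) * dmin av n x j \<le> (1 - u) * av (x i - x j)"
      using dmin_le' i that \<open>u < 1 / 2\<close> by (intro mult_left_mono) auto
    also have "\<dots> \<le> av (x i - x j) - u * dmin av n x i"
      using dmin_le [of i n j x] i that u by (simp add: algebra_simps)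
    also have "\<dots> \<le> av (x j - z)"
      using av_diff_triangle [of "x i" "x j" z] av_commute [of z "x j"] xu by simp
    finally have "av (W j) * ((1 - u) * dmin av n x j) \<le> av (W j) * av (x j - z)"
      by (intro mult_left_mono) auto
    then show ?thesis using d [OF that(1)] nz [OF that(1)] \<open>u < 1 / 2\<close> by (simp add: field_simps)
  qed
  then have "(\<Sum>j\<in>{..<n} - {i}. av (W j) / av (x j - z)) \<le> (\<Sum>j\<in>{..<n} - {i}. av (W j) / dmin av n x j) / (1 - u)"
    unfolding sum_divide_distrib by (intro sum_mono) auto
  also have "\<dots> \<le> a * t / (1 - u)"
    using sumW [OF i] \<open>u < 1 / 2\<close> by (intro divide_right_mono) auto
  finally have rest: "(\<Sum>j\<in>{..<n} - {i}. av (W j) / av (x j - z)) \<le> a * t / (1 - u)" .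
  have "(\<Sum>j<n. av (W j) / av (x j - z)) = av (W i) / av (x i - z) + (\<Sum>j\<in>{..<n} - {i}. av (W j) / av (x j - z))"
    using i by (subst sum.remove [of _ i]) auto
  moreover have "av (W i) / av (x i - z) \<le> t / u"
    using W [OF i] d [OF i] u by (simp add: xu field_simps)
  ultimately have "1 \<le> t / u + a * t / (1 - u)" using one rest by linarith
  then have "u * (1 - u) \<le> t * (1 - u) + a * t * u"
    using u \<open>u < 1 / 2\<close> by (simp add: field_simps)
  then have q: "0 \<le> u\<^sup>2 - (1 - (a - 1) * t) * u + t"
    by (simp add: algebra_simps power2_eq_square)
  \<comment> \<open>Let Q be the quadratic and B = 1 - (a - 1)t the sum of its roots. Then Q(u) -
    Q(h) = (u - h)(u + h - B), so u > h forces u >= B - h. The same factorization at 1/2, where Q <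
    0, shows B - h > 1/2.\<close>
  have "u \<le> h"
  proof (rule ccontr)
    assume "\<not> u \<le> h"
    have "(u - h) * (u + h - (1 - (a - 1) * t)) \<ge> 0"
      using q h(3) by (simp add: algebra_simps power2_eq_square)
    then have "1 - (a - 1) * t \<le> u + h" using \<open>\<not> u \<le> h\<close> by (simp add: zero_le_mult_iff)
    moreover have "(1 / 2 - h) * (1 / 2 + h - (1 - (a - 1) * t))
        = (2 * (a + 1) * t - 1) / 4 - (h\<^sup>2 - (1 - (a - 1) * t) * h + t)"
      by (simp add: field_simps power2_eq_square)
    then have "(1 / 2 - h) * (1 / 2 + h - (1 - (a - 1) * t)) < 0"
      using small h(3) by simp
    then have "1 / 2 + h < 1 - (a - 1) * t" using h(2) by (simp add: mult_less_0_iff)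
    ultimately show False using \<open>u < 1 / 2\<close> by linarith
  qed
  then have "av (x i - r k) \<le> h * dmin av n x i"
    using d [OF i] xu by (simp add: z_def)
  then show ?thesis using i by blast
qed

text \<open>Applying the interpolation identity to $(X - x_i) \prod_{m \ne k, l} (X - r_m)$ makes the
  argument insensitive to whether $r_k$ and $r_l$ coincide.\<close>

lemma at_most_one_root_in_disc:
  fixes x r :: "nat \<Rightarrow> 'a" and a t h :: real and n :: nat
  defines "W \<equiv> \<lambda>j. (\<Prod>m<n. x j - r m) / (\<Prod>m\<in>{..<n} - {j}. x j - x m)"
  assumes n: "2 \<le> n" and inj: "inj_on x {..<n}" and kl: "k < n" "l < n" and i: "i < n"
    and sumW: "(\<Sum>j\<in>{..<n} - {i}. av (W j) / dmin av n x j) \<le> a * t"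
    and h: "h < 1" and small: "a * t < (1 - h)\<^sup>2"
    and k: "av (x i - r k) \<le> h * dmin av n x i" and l: "av (x i - r l) \<le> h * dmin av n x i"
  shows "k = l"
proof (rule ccontr)
  assume "k \<noteq> l"
  have d: "0 < dmin av n x i" if "i < n" for i using dmin_pos n inj that by blast
  have far: "(1 - h) * av (x i - x j) \<le> av (x j - z)"
    if "j < n" "j \<noteq> i" "av (x i - z) \<le> h * dmin av n x i" for j z
  proof -
    have "0 \<le> h * dmin av n x i" using that av_nonneg [of "x i - z"] by linarith
    then have "0 \<le> h" using d [OF i] by (simp add: zero_le_mult_iff)
    then have "h * dmin av n x i \<le> h * av (x i - x j)"
      using dmin_le [of i n j x] i that by (intro mult_left_mono) auto
    then show ?thesis
      using av_diff_triangle [of "x i" "x j" z] av_commute [of z "x j"] that by (simp add: algebra_simps)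
  qed
  have far_nz: "x j - z \<noteq> 0" "av (x i - x j) > 0"
    if "j < n" "j \<noteq> i" "av (x i - z) \<le> h * dmin av n x i" for j z
  proof -
    show "av (x i - x j) > 0" using that i inj by (auto simp: inj_on_def)
    then have "0 < (1 - h) * av (x i - x j)" using h by simp
    then show "x j - z \<noteq> 0" using far [OF that] by auto
  qed
  define r' where "r' = r(k := x i)"
  define T where "T = {..<n} - {l}"
  have kT: "k \<in> T" "finite T" using kl \<open>k \<noteq> l\<close> by (auto simp: T_def)
  define c where "c j = (\<Prod>m\<in>T. x j - r' m) / (\<Prod>m\<in>{..<n} - {j}. x j - x m)" for j
  have "(\<Sum>j<n. c j) = 1"
    unfolding c_def T_def using inj kl by (intro lagrange_monic_sum) auto
  \<comment> \<open>The zero placed at x_i removes the only node that may be close to the two roots.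
    Every other x_j keeps distance at least (1 - h)|x_i - x_j| from both.\<close>
  moreover have "c i = 0" using kT by (auto simp: c_def r'_def)
  ultimately have "1 = av (\<Sum>j\<in>{..<n} - {i}. c j)"
    using i by (simp add: sum.remove [of _ i])
  also have "\<dots> \<le> (\<Sum>j\<in>{..<n} - {i}. av (c j))" by (rule av_sum)
  also have "\<dots> \<le> (\<Sum>j\<in>{..<n} - {i}. av (W j) / dmin av n x j / (1 - h)\<^sup>2)"
  proof (intro sum_mono)
    fix j assume "j \<in> {..<n} - {i}"
    then have j: "j < n" "j \<noteq> i" by auto
    note nz = far_nz [OF j k] far_nz [OF j l]
    define P where "P = (\<Prod>m\<in>T - {k}. x j - r m)"
    have "(\<Prod>m\<in>T. x j - r' m) = (x j - x i) * P"
      unfolding P_def using kT by (subst prod.remove [of _ k]) (auto simp: r'_def)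
    moreover have "(\<Prod>m<n. x j - r m) = (x j - r l) * ((x j - r k) * P)"
    proof -
      have "(\<Prod>m<n. x j - r m) = (x j - r l) * (\<Prod>m\<in>T. x j - r m)"
        using kl by (simp add: prod.remove [of _ l] T_def)
      then show ?thesis using kT by (simp add: prod.remove [of _ k] P_def)
    qed
    ultimately have "c j = W j * (x j - x i) / ((x j - r k) * (x j - r l))"
      using nz by (simp add: c_def W_def)
    then have "av (c j) = av (W j) * av (x i - x j) / (av (x j - r k) * av (x j - r l))"
      by (simp add: av_divide av_mult av_commute)
    also have "\<dots> \<le> av (W j) * av (x i - x j) / (((1 - h) * av (x i - x j)) * ((1 - h) * av (x i - x j)))"
      using far [OF j k] far [OF j l] nz h
      by (intro divide_left_mono mult_mono mult_pos_pos mult_nonneg_nonneg) auto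
    also have "\<dots> = av (W j) / av (x i - x j) / (1 - h)\<^sup>2"
      using nz(2) h by (simp add: power2_eq_square)
    also have "\<dots> \<le> av (W j) / dmin av n x j / (1 - h)\<^sup>2"
      using dmin_le' [of i n j x] i j d [of j] nz(2)
      by (intro divide_right_mono divide_left_mono) auto
    finally show "av (c j) \<le> av (W j) / dmin av n x j / (1 - h)\<^sup>2" .
  qed
  also have "\<dots> \<le> a * t / (1 - h)\<^sup>2"
    unfolding sum_divide_distrib [symmetric] using sumW by (intro divide_right_mono) auto
  also have "\<dots> < 1" using small h by (simp add: field_simps)
  finally show False by simp
qed

text \<open>Isolating the term j = i of the identity gives W_i = (x_i - z)(1 - S). The remainder
  \<open>S\<close> is at most a t/(1 - h), because the other nodes stay away from the disc around
  x_i.\<close>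

lemma weierstrass_correction_bound:
  fixes x r :: "nat \<Rightarrow> 'a" and a t h :: real and n :: nat
  defines "W \<equiv> \<lambda>j. (\<Prod>m<n. x j - r m) / (\<Prod>m\<in>{..<n} - {j}. x j - x m)"
  assumes n: "2 \<le> n" and inj: "inj_on x {..<n}" and k: "k < n" and i: "i < n"
    and sumW: "(\<Sum>j\<in>{..<n} - {i}. av (W j) / dmin av n x j) \<le> a * t"
    and h: "0 \<le> h" "h < 1"
    and near: "av (x i - r k) \<le> h * dmin av n x i"
  shows "av (x i - r k) * (1 - a * t / (1 - h)) \<le> av (W i)"
proof (cases "x i = r k")
  case False
  have d: "0 < dmin av n x i" if "i < n" for i using dmin_pos n inj that by blast
  define z where "z = r k"
  have far: "(1 - h) * dmin av n x j \<le> av (x j - z)" if "j < n" "j \<noteq> i" for j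
  proof -
    have "h * dmin av n x i \<le> h * av (x i - x j)"
      using dmin_le [of i n j x] i that h by (intro mult_left_mono) auto
    then have "(1 - h) * av (x i - x j) \<le> av (x j - z)"
      using av_diff_triangle [of "x i" "x j" z] av_commute [of z "x j"] near by (simp add: algebra_simps z_def)
    moreover have "(1 - h) * dmin av n x j \<le> (1 - h) * av (x i - x j)"
      using dmin_le' [of i n j x] i that h by (intro mult_left_mono) auto
    ultimately show ?thesis by linarith
  qed
  have nz: "x j - z \<noteq> 0" if "j < n" for j
  proof (cases "j = i")
    case False
    then show ?thesis using far [OF that] d [OF that] h by (metis av_0 diff_gt_0_iff_gt leD mult_pos_pos)
  qed (use False in \<open>simp add: z_def\<close>)
  define S where "S = (\<Sum>j\<in>{..<n} - {i}. W j / (x j - z))"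
  have "(\<Sum>j<n. W j / (x j - z)) = 1"
    unfolding W_def z_def using inj k nz by (intro weierstrass_sum_at_root) (auto simp: z_def)
  then have "W i / (x i - z) + S = 1"
    using i by (simp add: sum.remove [of _ i] S_def)
  then have "W i / (x i - z) = 1 - S" by (simp add: algebra_simps)
  then have "W i = (x i - z) * (1 - S)"
    using nz [OF i] by (metis nonzero_mult_div_cancel_left times_divide_eq_right)
  then have Wi: "av (W i) = av (x i - z) * av (1 - S)" by (simp add: av_mult)
  have "av S \<le> (\<Sum>j\<in>{..<n} - {i}. av (W j) / av (x j - z))"
    unfolding S_def using av_sum [of "\<lambda>j. W j / (x j - z)" "{..<n} - {i}"] by (simp add: av_divide)
  also have "\<dots> \<le> (\<Sum>j\<in>{..<n} - {i}. av (W j) / dmin av n x j / (1 - h))"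
  proof (intro sum_mono)
    fix j assume "j \<in> {..<n} - {i}"
    then have j: "j < n" "j \<noteq> i" by auto
    have "av (W j) / av (x j - z) \<le> av (W j) / ((1 - h) * dmin av n x j)"
      using far [OF j] nz [OF j(1)] d [OF j(1)] h by (intro divide_left_mono) auto
    then show "av (W j) / av (x j - z) \<le> av (W j) / dmin av n x j / (1 - h)"
      by (simp add: mult.commute)
  qed
  also have "\<dots> \<le> a * t / (1 - h)"
    unfolding sum_divide_distrib [symmetric] using sumW h by (intro divide_right_mono) auto
  finally have "1 - a * t / (1 - h) \<le> av (1 - S)"
    using av_triangle [of "1 - S" S] by simp
  then show ?thesis unfolding Wi z_def by (intro mult_left_mono) auto
qed simp

end

section \<open>Matching the roots with the nodes\<close>

lemma Psi_mono:
  assumes "1 \<le> p" "2 \<le> n" "0 \<le> s" "s \<le> t"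
  shows "Psi n p s \<le> Psi n p t"
  unfolding Psi_def using assms
  by (intro mult_mono power_mono add_left_mono divide_right_mono add_nonneg_nonneg
      divide_nonneg_nonneg zero_le_power) auto

context absval
begin

text \<open>Assigning to each root index a disc that contains its root is injective, hence
  bijective; \<open>\<xi>\<close> lists the roots along the inverse \<open>\<tau>\<close>. The lemma
  serves the initial vector and, for the error estimate, the iterates.\<close>

lemma root_vector_near:
  fixes f :: "'a poly"
  assumes alg: "alg_closed_field TYPE('a)" and deg: "degree f = n" and n: "2 \<le> n" and p: "1 \<le> p"
    and inj: "inj_on x {..<n}"
    and t: "E_f av p f n x \<le> 1 / (1 + sqrt (a_param n p))\<^sup>2"
    and Om: "Omega n p (a_param n p) (E_f av p f n x) < 2"
  obtains \<xi> where "f = smult (lead_coeff f) (\<Prod>i<n. [:- \<xi> i, 1:])"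
    "\<And>i. i < n \<Longrightarrow> av (x i - \<xi> i) \<le> h_fun (a_param n p) (E_f av p f n x) * dmin av n x i"
    "\<And>i. i < n \<Longrightarrow> av (x i - \<xi> i) \<le> alpha_fun (a_param n p) (E_f av p f n x) * av (W_corr f n x i)"
proof -
  define a where "a = a_param n p"
  define t where "t = E_f av p f n x"
  define h where "h = h_fun a t"
  define \<alpha> where "\<alpha> = alpha_fun a t"
  have a: "1 \<le> a" using a_param_ge_1 p n by (simp add: a_def)
  have d: "0 < dmin av n x i" if "i < n" for i using dmin_pos n inj that by blast
  have t0: "0 \<le> t" unfolding t_def E_f_def using n p by (intro pnorm_nonneg) auto
  have tle: "t \<le> 1 / (1 + sqrt a)\<^sup>2" using t by (simp add: t_def a_def)
  note hp = h_fun_props [OF a t0 tle, folded h_def \<alpha>_def]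
  have "Psi n p h < 2" using Om by (simp add: Omega_def h_def t_def a_def)
  note small = Psi_less_2_imp [OF p n hp(2) this, folded a_def]
  note bounds = disc_radius_bounds [OF a hp(2,4) small(2)]
  obtain r where r: "f = smult (lead_coeff f) (\<Prod>i<n. [:- r i, 1:])"
    using alg_closed_field_factorization [OF alg, of f] deg n by fastforce
  have lc: "lead_coeff f \<noteq> 0" using deg n by auto
  have Wr: "W_corr f n x j = (\<Prod>m<n. x j - r m) / (\<Prod>m\<in>{..<n} - {j}. x j - x m)" for j
  proof -
    have "poly f (x j) = lead_coeff f * (\<Prod>m<n. x j - r m)"
      by (subst r) (simp add: prod_linear_poly del: prod_constant)
    then show ?thesis using lc by (simp add: W_corr_def)
  qed
  have sumW: "(\<Sum>j\<in>{..<n} - {i}. av (W_corr f n x j) / dmin av n x j) \<le> a * t" if "i < n" for i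
    unfolding a_def t_def E_f_def using p n that d
    by (intro sum_except_le_pnorm) (auto intro: divide_nonneg_pos)
  have W: "av (W_corr f n x i) / dmin av n x i \<le> t" if "i < n" for i
    using abs_le_pnorm [OF p that, of "\<lambda>i. av (W_corr f n x i) / dmin av n x i"] 
    d [OF that] by (simp add: t_def E_f_def)
  have "\<exists>i<n. av (x i - r k) \<le> h * dmin av n x i" if "k < n" for k
    using that sumW W hp(2,4) small(1) bounds(1) a t0 unfolding Wr
    by (intro root_in_disc [OF n inj, where a = a and t = t]) auto
  then obtain \<sigma> where \<sigma>: "\<And>k. k < n \<Longrightarrow> \<sigma> k < n"
      "\<And>k. k < n \<Longrightarrow> av (x (\<sigma> k) - r k) \<le> h * dmin av n x (\<sigma> k)"
    by metis
  have "k = l" if "k < n" "l < n" "\<sigma> k = \<sigma> l" for k l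
  proof (rule at_most_one_root_in_disc [OF n inj that(1,2), where r = r and i = "\<sigma> k" and h = h and a = a and t = t])
    show "av (x (\<sigma> k) - r l) \<le> h * dmin av n x (\<sigma> k)" using \<sigma>(2) that by simp
    show "av (x (\<sigma> k) - r k) \<le> h * dmin av n x (\<sigma> k)" using \<sigma>(2) that(1) by blast
  qed (use \<sigma>(1) that sumW [OF \<sigma>(1), unfolded Wr] bounds(2) small(1) in auto)
  then have "inj_on \<sigma> {..<n}" by (auto simp: inj_on_def)
  then have bij: "bij_betw \<sigma> {..<n} {..<n}"
    using \<sigma>(1) endo_inj_surj [of "{..<n}" \<sigma>] by (auto simp: bij_betw_def)
  define \<tau> where "\<tau> = inv_into {..<n} \<sigma>"
  have bij': "bij_betw \<tau> {..<n} {..<n}" unfolding \<tau>_def by (rule bij_betw_inv_into [OF bij])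
  have \<tau>: "\<tau> i < n" "\<sigma> (\<tau> i) = i" if "i < n" for i
    using bij_betwE [OF bij'] bij_betw_inv_into_right [OF bij] that by (auto simp: \<tau>_def)
  show thesis
  proof (rule that [of "r \<circ> \<tau>"])
    show "f = smult (lead_coeff f) (\<Prod>i<n. [:- (r \<circ> \<tau>) i, 1:])"
      using r prod.reindex_bij_betw [OF bij', of "\<lambda>i. [:- r i, 1:]"] by simp
  next
    fix i assume i: "i < n"
    show near: "av (x i - (r \<circ> \<tau>) i) \<le> h_fun (a_param n p) (E_f av p f n x) * dmin av n x i"
      using \<sigma>(2) [of "\<tau> i"] \<tau> [OF i] by (simp add: h_def a_def t_def)
    have "av (x i - r (\<tau> i)) * (1 - a * t / (1 - h)) \<le> av (W_corr f n x i)"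
      using weierstrass_correction_bound [OF n inj \<tau>(1) [OF i] i, of r a t h] sumW [OF i] hp(2) small(1) near
      unfolding Wr by (simp add: h_def a_def t_def)
    then have "\<alpha> * (av (x i - r (\<tau> i)) * (1 - a * t / (1 - h))) \<le> \<alpha> * av (W_corr f n x i)"
      using hp(1) by (intro mult_left_mono) auto
    moreover have "\<alpha> * (1 - a * t / (1 - h)) = 1"
      using hp(5) small(1) by (simp add: field_simps)
    then have "\<alpha> * (av (x i - r (\<tau> i)) * (1 - a * t / (1 - h))) = av (x i - r (\<tau> i))"
      by (metis mult.assoc mult.commute mult.right_neutral)
    ultimately have "av (x i - r (\<tau> i)) \<le> \<alpha> * av (W_corr f n x i)" by linarith
    then show "av (x i - (r \<circ> \<tau>) i) \<le> alpha_fun (a_param n p) (E_f av p f n x) * av (W_corr f n x i)"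
      by (simp add: \<alpha>_def a_def t_def)
  qed
qed

section \<open>Contraction of the Weierstrass-type maps\<close>

text \<open>The new error is (x_i - xi_i)(1 - prod_j (x_i - xi_j)/(x_i - y_j)), and each factor is 1
  + u_j with |u_j| <= l kappa e_j. Here \<open>l\<close> compares the errors of y and x, and
  \<open>\<kappa>\<close> accounts for dividing by x_i - y_j instead of by d_j.\<close>

lemma weierstrass_type_step:
  fixes f :: "'a poly" and x y \<xi> :: "nat \<Rightarrow> 'a" and n :: nat
  defines "e \<equiv> \<lambda>j. av (x j - \<xi> j) / dmin av n x j"
  assumes f: "f = smult (lead_coeff f) (\<Prod>i<n. [:- \<xi> i, 1:])" "f \<noteq> 0"
    and n: "2 \<le> n" and p: "1 \<le> p" and inj: "inj_on x {..<n}" and i: "i < n"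
    and far: "\<And>j. \<lbrakk>j < n; j \<noteq> i\<rbrakk> \<Longrightarrow> dmin av n x j \<le> \<kappa> * av (x i - y j)"
    and near: "\<And>j. j < n \<Longrightarrow> av (y j - \<xi> j) \<le> l * av (x j - \<xi> j)"
    and l: "0 \<le> l" "0 < \<kappa>" "l * \<kappa> \<le> 1"
  shows "av (x i - poly f (x i) / (lead_coeff f * (\<Prod>j\<in>{..<n} - {i}. x i - y j)) - \<xi> i)
    \<le> l * \<kappa> * ((1 + pnorm p n e / (real n - 1) powr inv_exp p) ^ (n - 1) - 1) * av (x i - \<xi> i)"
proof -
  have d: "0 < dmin av n x i" if "i < n" for i using dmin_pos n inj that by blast
  have lc: "lead_coeff f \<noteq> 0" using f(2) by simp
  have pf: "poly f (x i) = lead_coeff f * (\<Prod>m<n. x i - \<xi> m)"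
    by (subst f(1)) (simp add: prod_linear_poly del: prod_constant)
  define u where "u j = (y j - \<xi> j) / (x i - y j)" for j
  have nz: "x i - y j \<noteq> 0" if "j < n" "j \<noteq> i" for j
    using far [OF that] d [OF that(1)] by auto
  have ule: "av (u j) \<le> l * \<kappa> * e j" if "j < n" "j \<noteq> i" for j
  proof -
    have "av (y j - \<xi> j) * dmin av n x j \<le> l * av (x j - \<xi> j) * (\<kappa> * av (x i - y j))"
      using near far that d [OF that(1)] l by (intro mult_mono) auto
    then show ?thesis using nz [OF that] d [OF that(1)]
      by (simp add: u_def av_divide e_def field_simps)
  qed
  have e: "0 \<le> e j" if "j < n" for j using d [OF that] by (simp add: e_def)
  have E: "0 \<le> pnorm p n e" using p n by (intro pnorm_nonneg) auto
  have "poly f (x i) / (lead_coeff f * (\<Prod>j\<in>{..<n} - {i}. x i - y j))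
      = (x i - \<xi> i) * (\<Prod>j\<in>{..<n} - {i}. (x i - \<xi> j) / (x i - y j))"
    unfolding pf using lc i by (simp add: prod_dividef prod.remove [of "{..<n}" i])
  also have "(\<Prod>j\<in>{..<n} - {i}. (x i - \<xi> j) / (x i - y j)) = (\<Prod>j\<in>{..<n} - {i}. 1 + u j)"
    using nz by (intro prod.cong) (auto simp: u_def add_divide_distrib [symmetric] divide_simps)
  finally have "x i - poly f (x i) / (lead_coeff f * (\<Prod>j\<in>{..<n} - {i}. x i - y j)) - \<xi> i
      = (x i - \<xi> i) * (1 - (\<Prod>j\<in>{..<n} - {i}. 1 + u j))"
    by (simp add: algebra_simps)
  moreover have "av (1 - (\<Prod>j\<in>{..<n} - {i}. 1 + u j)) \<le> (\<Prod>j\<in>{..<n} - {i}. 1 + av (u j)) - 1"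
    by (rule av_prod_one_plus_diff) simp
  moreover have "(\<Prod>j\<in>{..<n} - {i}. 1 + av (u j)) \<le> (\<Prod>j\<in>{..<n} - {i}. 1 + l * \<kappa> * e j)"
    using ule by (intro prod_mono) (auto simp: add_nonneg_nonneg)
  moreover have "\<dots> \<le> (1 + pnorm p n (\<lambda>j. l * \<kappa> * e j) / (real n - 1) powr inv_exp p) ^ (n - 1)"
    using n p i e l by (intro prod_except_le_pnorm) auto
  moreover have "\<dots> = (1 + l * \<kappa> * (pnorm p n e / (real n - 1) powr inv_exp p)) ^ (n - 1)"
    using n p l by (subst pnorm_cmult) auto
  \<comment> \<open>Convexity, applicable since \<open>l * \<kappa> \<le> 1\<close>. Having the gain
    as a plain factor lets it accumulate from one level of \<open>T_map\<close> to the next.\<close>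
  moreover have "\<dots> - 1 \<le> l * \<kappa> * ((1 + pnorm p n e / (real n - 1) powr inv_exp p) ^ (n - 1) - 1)"
    using l E by (intro power_one_plus_scaled_le) auto
  ultimately have "av (x i - poly f (x i) / (lead_coeff f * (\<Prod>j\<in>{..<n} - {i}. x i - y j)) - \<xi> i)
      = av (x i - \<xi> i) * av (1 - (\<Prod>j\<in>{..<n} - {i}. 1 + u j))"
    "av (1 - (\<Prod>j\<in>{..<n} - {i}. 1 + u j)) \<le> l * \<kappa> * ((1 + pnorm p n e / (real n - 1) powr inv_exp p) ^ (n - 1) - 1)"
    by (auto simp: av_mult)
  then show ?thesis by (simp add: mult_left_mono mult.commute [of _ "av (x i - \<xi> i)"])
qed

end

text \<open>Bounds the factor by which one Weierstrass step reduces the error of \<open>x\<close> when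
  $\|(x - \xi) / d(x)\|_p$ equals \<open>E\<close>.\<close>

definition beta_fun :: "nat \<Rightarrow> ereal \<Rightarrow> real \<Rightarrow> real" where
  "beta_fun n p E = (1 + E / (real n - 1) powr inv_exp p) ^ (n - 1) - 1"

lemma beta_fun_bounds:
  assumes "0 \<le> E" "Psi n p E < 2"
  shows "0 \<le> beta_fun n p E" "beta_fun n p E * (1 + 2 * E) < 1 - 2 * E"
    "(1 + beta_fun n p E) * (1 + 2 * E) < 2"
proof -
  show "0 \<le> beta_fun n p E"
    unfolding beta_fun_def using assms by (simp add: one_le_power)
  show *: "(1 + beta_fun n p E) * (1 + 2 * E) < 2"
    using assms by (simp add: beta_fun_def Psi_def mult.commute)
  then show "beta_fun n p E * (1 + 2 * E) < 1 - 2 * E"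
    by (simp add: algebra_simps)
qed

context absval
begin

definition rel_err :: "ereal \<Rightarrow> nat \<Rightarrow> (nat \<Rightarrow> 'a) \<Rightarrow> (nat \<Rightarrow> 'a) \<Rightarrow> real" where
  "rel_err p n \<xi> x = pnorm p n (\<lambda>i. av (x i - \<xi> i) / dmin av n x i)"

lemma rel_err_nonneg: "\<lbrakk>1 \<le> p; 2 \<le> n\<rbrakk> \<Longrightarrow> 0 \<le> rel_err p n \<xi> x"
  unfolding rel_err_def by (intro pnorm_nonneg) auto

lemma av_diff_le_rel_err:
  assumes "1 \<le> p" "2 \<le> n" "inj_on x {..<n}" "i < n"
  shows "av (x i - \<xi> i) \<le> rel_err p n \<xi> x * dmin av n x i"
  using abs_le_pnorm [OF assms(1,4), of "\<lambda>i. av (x i - \<xi> i) / dmin av n x i"]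
    dmin_pos [OF assms(2,4,3)] by (simp add: rel_err_def field_simps)

lemma perturbed_separation:
  assumes "av (x' - x) \<le> s * av (x - y)" "av (y' - y) \<le> r * av (x - y)"
  shows "(1 - s - r) * av (x - y) \<le> av (x' - y')"
proof -
  have "av (x - y) \<le> av (x - x') + (av (x' - y') + av (y' - y))"
    using av_diff_triangle [of x y x'] av_diff_triangle [of x' y y'] by linarith
  then show ?thesis using assms av_commute [of x x'] by (simp add: algebra_simps)
qed

text \<open>Level 1 is the step with y = x and both constants 1. A further level uses
  \<open>l = \<beta> * \<rho> ^ M\<close> from the induction hypothesis and the separation constant
  \<open>1 + 2 * E\<close>, so it contributes one more factor \<open>\<rho>\<close>.\<close>

lemma T_map_error:
  fixes f :: "'a poly" and x \<xi> :: "nat \<Rightarrow> 'a" and n :: nat and p :: ereal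
  defines "E \<equiv> rel_err p n \<xi> x"
  assumes f: "f = smult (lead_coeff f) (\<Prod>i<n. [:- \<xi> i, 1:])" "f \<noteq> 0"
    and n: "2 \<le> n" and p: "1 \<le> p" and inj: "inj_on x {..<n}" and Psi: "Psi n p E < 2"
  defines "\<beta> \<equiv> beta_fun n p E"
  shows "x \<in> D_dom f n (Suc M) \<and>
    (\<forall>i<n. av (T_map f n (Suc M) x i - \<xi> i) \<le> \<beta> * (\<beta> * (1 + 2 * E)) ^ M * av (x i - \<xi> i))"
proof (induction M)
  case 0
  have "x \<in> D_dom f n (Suc 0)" using inj by (auto simp: inj_on_def)
  moreover have "av (T_map f n (Suc 0) x i - \<xi> i) \<le> 1 * 1 * \<beta> * av (x i - \<xi> i)" if "i < n" for i
    unfolding T_map.simps \<beta>_def beta_fun_def E_def rel_err_def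
    using that dmin_le' [of i n] by (intro weierstrass_type_step [OF f n p inj]) auto
  ultimately show ?case by simp
next
  case (Suc M)
  have E: "0 \<le> E" unfolding E_def using rel_err_nonneg n p by blast
  note \<beta> = beta_fun_bounds [OF E Psi, folded \<beta>_def]
  define \<rho> where "\<rho> = \<beta> * (1 + 2 * E)"
  have \<rho>: "0 \<le> \<rho>" "\<rho> < 1" using \<beta> E by (auto simp: \<rho>_def)
  have \<rho>M: "0 \<le> \<rho> ^ M" "\<rho> ^ M \<le> 1" using \<rho> by (auto intro: power_le_one)
  define y where "y = T_map f n (Suc M) x"
  have y: "av (y j - \<xi> j) \<le> \<beta> * \<rho> ^ M * av (x j - \<xi> j)" if "j < n" for j
    using Suc.IH that by (auto simp: y_def \<rho>_def)
  have sep: "av (x i - x j) \<le> (1 + 2 * E) * av (x i - y j)" if "i < n" "j < n" "i \<noteq> j" for i j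
  proof -
    have "\<beta> * \<rho> ^ M * av (x j - \<xi> j) \<le> \<beta> * 1 * av (x j - \<xi> j)"
      using \<beta>(1) \<rho>M by (intro mult_right_mono mult_left_mono) auto
    then have "av (y j - x j) \<le> (1 + \<beta>) * av (x j - \<xi> j)"
      using av_diff_triangle [of "y j" "x j" "\<xi> j"] av_commute [of "x j" "\<xi> j"] y [OF that(2)]
      by (simp add: algebra_simps)
    also have "\<dots> \<le> (1 + \<beta>) * (E * dmin av n x j)"
      using av_diff_le_rel_err [OF p n inj that(2)] \<beta>(1) by (intro mult_left_mono) (auto simp: E_def)
    also have "\<dots> \<le> (1 + \<beta>) * (E * av (x i - x j))"
      using dmin_le' that \<beta>(1) E by (intro mult_left_mono) auto
    finally have "(1 - 0 - (1 + \<beta>) * E) * av (x i - x j) \<le> av (x i - y j)"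
      by (intro perturbed_separation) (auto simp: mult.assoc)
    then have "(1 + 2 * E) * ((1 - (1 + \<beta>) * E) * av (x i - x j)) \<le> (1 + 2 * E) * av (x i - y j)"
      using E by (intro mult_left_mono) auto
    \<comment> \<open>The right side equals 1 + 2E - E(1 + beta)(1 + 2E), and (1 + beta)(1 + 2E) =
      Psi(E) < 2.\<close>
    moreover have "1 \<le> (1 + 2 * E) * (1 - (1 + \<beta>) * E)"
      using mult_left_mono [OF less_imp_le [OF \<beta>(3)] E] by (simp add: algebra_simps)
    then have "1 * av (x i - x j) \<le> (1 + 2 * E) * (1 - (1 + \<beta>) * E) * av (x i - x j)"
      by (rule mult_right_mono) simp
    ultimately show ?thesis by (simp only: mult.assoc mult_1)
  qed
  have "x i \<noteq> y j" if "i < n" "j < n" "i \<noteq> j" for i j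
  proof
    assume "x i = y j"
    then have "av (x i - x j) \<le> 0" using sep [OF that] by simp
    then have "x i = x j" using av_nonneg [of "x i - x j"] by (simp add: antisym)
    then show False using that inj by (auto simp: inj_on_def)
  qed
  then have "x \<in> D_dom f n (Suc (Suc M))"
    using Suc.IH unfolding y_def D_dom.simps(2) [of f n "Suc M"] by blast
  moreover have "av (T_map f n (Suc (Suc M)) x i - \<xi> i) \<le> \<beta> * \<rho> ^ M * (1 + 2 * E) * \<beta> * av (x i - \<xi> i)"
    if "i < n" for i
    unfolding T_map.simps(2) [of f n "Suc M"] y_def [symmetric]
  proof (rule weierstrass_type_step [OF f n p inj that, of "1 + 2 * E" y "\<beta> * \<rho> ^ M", folded rel_err_def, folded E_def beta_fun_def, folded \<beta>_def])
    show "dmin av n x j \<le> (1 + 2 * E) * av (x i - y j)" if "j < n" "j \<noteq> i" for j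
      using sep [of i j] dmin_le' [of i n j x] \<open>i < n\<close> that by force
    have "\<beta> * \<rho> ^ M * (1 + 2 * E) = \<rho> ^ Suc M" by (simp add: \<rho>_def)
    also have "\<dots> \<le> 1" using \<rho> by (intro power_le_one) auto
    finally show "\<beta> * \<rho> ^ M * (1 + 2 * E) \<le> 1" .
  qed (use y \<beta>(1) \<rho>M E in auto)
  moreover have "\<beta> * \<rho> ^ M * (1 + 2 * E) * \<beta> = \<beta> * \<rho> ^ Suc M" by (simp add: \<rho>_def)
  ultimately show ?case unfolding \<rho>_def by (simp only:) simp
qed

text \<open>Errors shrink by \<open>\<beta>\<close>, distances between components by no worse than
  \<open>\<theta>\<close>, and \<open>\<beta> \<le> \<theta>\<close>, so no quotient grows. Only
  contraction by \<open>\<beta>\<close> enters, which holds at every level N >= 1.\<close>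

lemma T_map_rel_err:
  fixes f :: "'a poly" and x \<xi> :: "nat \<Rightarrow> 'a" and n :: nat and p :: ereal
  defines "E \<equiv> rel_err p n \<xi> x"
  assumes n: "2 \<le> n" and p: "1 \<le> p" and inj: "inj_on x {..<n}" and Psi: "Psi n p E < 2"
    and x': "\<And>i. i < n \<Longrightarrow> av (x' i - \<xi> i) \<le> beta_fun n p E * av (x i - \<xi> i)"
  shows "inj_on x' {..<n}" "rel_err p n \<xi> x' \<le> E"
proof -
  have E: "0 \<le> E" unfolding E_def using rel_err_nonneg n p by blast
  define \<beta> where "\<beta> = beta_fun n p E"
  note \<beta> = beta_fun_bounds [OF E Psi, folded \<beta>_def]
  \<comment> \<open>Both ends of a difference move by at most (1 + beta)E|x_i - x_j|, and Psi(E) < 2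
    gives 1 - 2(1 + beta)E >= 1 - 4E/(1 + 2E), which is \<open>\<theta>\<close>.\<close>
  define \<theta> where "\<theta> = (1 - 2 * E) / (1 + 2 * E)"
  have "0 \<le> \<beta> * (1 + 2 * E)" using \<beta>(1) E by simp
  then have \<theta>: "0 < \<theta>" "\<beta> \<le> \<theta>" using \<beta>(2) E by (auto simp: \<theta>_def field_simps)
  have move: "av (x' i - x i) \<le> (1 + \<beta>) * E * av (x i - x j)" if "i < n" "j < n" "i \<noteq> j" for i j
  proof -
    have "av (x' i - x i) \<le> (1 + \<beta>) * av (x i - \<xi> i)"
      using av_diff_triangle [of "x' i" "x i" "\<xi> i"] av_commute [of "x i" "\<xi> i"] x' [OF that(1)]
      by (simp add: algebra_simps \<beta>_def)
    also have "\<dots> \<le> (1 + \<beta>) * (E * dmin av n x i)"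
      using av_diff_le_rel_err [OF p n inj that(1)] \<beta>(1) by (intro mult_left_mono) (auto simp: E_def)
    also have "\<dots> \<le> (1 + \<beta>) * (E * av (x i - x j))"
      using dmin_le that \<beta>(1) E by (intro mult_left_mono) auto
    finally show ?thesis by (simp only: mult.assoc)
  qed
  have sep: "\<theta> * av (x i - x j) \<le> av (x' i - x' j)" if "i < n" "j < n" "i \<noteq> j" for i j
  proof -
    have "(1 - (1 + \<beta>) * E - (1 + \<beta>) * E) * av (x i - x j) \<le> av (x' i - x' j)"
      using move [of i j] move [of j i] that av_commute [of "x i" "x j"]
      by (intro perturbed_separation) auto
    moreover have "\<theta> \<le> 1 - (1 + \<beta>) * E - (1 + \<beta>) * E"
      using mult_left_mono [OF less_imp_le [OF \<beta>(3)] E] E by (simp add: \<theta>_def field_simps)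
    ultimately show ?thesis
      by (meson av_nonneg mult_right_mono order_trans)
  qed
  show inj': "inj_on x' {..<n}"
  proof (rule inj_onI, rule ccontr)
    fix i j assume ij: "i \<in> {..<n}" "j \<in> {..<n}" "x' i = x' j" "i \<noteq> j"
    then have "\<theta> * av (x i - x j) \<le> 0" using sep [of i j] by simp
    moreover have "0 < av (x i - x j)" using ij inj by (auto simp: inj_on_def)
    ultimately show False using \<theta>(1) by (simp add: mult_le_0_iff)
  qed
  have d: "0 < dmin av n x i" "0 < dmin av n x' i" "\<theta> * dmin av n x i \<le> dmin av n x' i" if "i < n" for i
  proof -
    show "\<theta> * dmin av n x i \<le> dmin av n x' i"
    proof (rule le_dmin [OF n])
      fix j assume "j < n" "j \<noteq> i"
      then have "\<theta> * dmin av n x i \<le> \<theta> * av (x i - x j)"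
        using dmin_le [of i n j x] \<theta>(1) that by simp
      then show "\<theta> * dmin av n x i \<le> av (x' i - x' j)"
        using sep [of i j] that \<open>j < n\<close> \<open>j \<noteq> i\<close> by force
    qed
  qed (use dmin_pos n inj inj' that in auto)
  have "av (x' i - \<xi> i) / dmin av n x' i \<le> av (x i - \<xi> i) / dmin av n x i" if "i < n" for i
  proof -
    have "av (x' i - \<xi> i) / dmin av n x' i \<le> \<theta> * av (x i - \<xi> i) / (\<theta> * dmin av n x i)"
      using x' [OF that] mult_right_mono [OF \<theta>(2), of "av (x i - \<xi> i)"] d [OF that] \<theta>(1)
      by (intro frac_le) (auto simp: \<beta>_def)
    then show ?thesis using \<theta>(1) by simp
  qed
  then show "rel_err p n \<xi> x' \<le> E"
    unfolding E_def rel_err_def using n p d by (intro pnorm_mono) (auto simp: abs_of_pos)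
qed

end

section \<open>From relative to absolute errors; uniqueness of the nearby root-vector\<close>

lemma beta_fun_mono:
  assumes "2 \<le> n" "0 \<le> s" "s \<le> t"
  shows "beta_fun n p s \<le> beta_fun n p t"
  unfolding beta_fun_def using assms
  by (intro diff_right_mono power_mono add_left_mono divide_right_mono add_nonneg_nonneg) auto

text \<open>Chord bound for a convex function vanishing at 0; it supplies the powers of the error in
  the order of convergence.\<close>

lemma beta_fun_le_linear:
  assumes "0 \<le> E" "E \<le> 1"
  shows "beta_fun n p E \<le> E * beta_fun n p 1"
  using power_one_plus_scaled_le [of E "1 / (real n - 1) powr inv_exp p" "n - 1"] assms
  by (simp add: beta_fun_def)

lemma root_vectorI_prod:
  fixes f :: "'a::field poly"
  assumes "f = smult (lead_coeff f) (\<Prod>i<n. [:- \<xi> i, 1:])"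
  shows "root_vector f n \<xi>"
proof -
  have "poly f z = lead_coeff f * (\<Prod>i<n. z - \<xi> i)" for z
    by (subst assms) (simp add: prod_linear_poly del: prod_constant)
  then show ?thesis by (simp add: root_vector_def)
qed

context absval
begin

text \<open>The open discs of radius d_i(x)/2 around the x_i are disjoint. Since
  \<open>\<eta> i\<close> is some \<open>\<xi> j\<close>, an index j other than i would place one
  root in two discs.\<close>

lemma near_root_vector_unique:
  fixes f :: "'a poly"
  assumes "root_vector f n \<xi>" "root_vector f n \<eta>" and "f \<noteq> 0"
    and \<xi>: "\<And>i. i < n \<Longrightarrow> 2 * av (x i - \<xi> i) < dmin av n x i"
    and \<eta>: "\<And>i. i < n \<Longrightarrow> 2 * av (x i - \<eta> i) < dmin av n x i"
    and i: "i < n"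
  shows "\<eta> i = \<xi> i"
proof -
  have "lead_coeff f * (\<Prod>j<n. \<eta> i - \<eta> j) = 0" using i by (auto intro!: bexI [of _ i])
  then have "lead_coeff f * (\<Prod>j<n. \<eta> i - \<xi> j) = 0"
    using assms(1,2) by (metis root_vector_def)
  then obtain j where j: "j < n" "\<eta> i = \<xi> j" using \<open>f \<noteq> 0\<close> by auto
  have "j = i"
  proof (rule ccontr)
    assume "j \<noteq> i"
    then have "2 * av (x i - x j) < av (x i - x j) + av (x i - x j)"
      using \<eta> [OF i] \<xi> [OF j(1)] dmin_le [of i n j x] dmin_le' [of i n j x] i j
        av_diff_triangle [of "x i" "x j" "\<xi> j"] av_commute [of "\<xi> j" "x j"] by simp
    then show False by simp
  qed
  then show ?thesis using j by simp
qed

text \<open>The order of convergence needs a constant independent of the iterate, while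
  \<open>rel_err\<close> divides by d_i(x). A relative error of at most 1/2 ensures d_i(x) >=
  d_i(xi)/2.\<close>

lemma rel_err_le_pnorm:
  assumes n: "2 \<le> n" and p: "1 \<le> p" and inj: "inj_on x {..<n}" and half: "2 * rel_err p n \<xi> x \<le> 1"
    and inj\<xi>: "inj_on \<xi> {..<n}"
  shows "rel_err p n \<xi> x \<le> (\<Sum>i<n. 2 / dmin av n \<xi> i) * pnorm p n (\<lambda>i. av (x i - \<xi> i))"
proof -
  define K where "K = (\<Sum>i<n. 2 / dmin av n \<xi> i)"
  have d: "0 < dmin av n x i" "0 < dmin av n \<xi> i" if "i < n" for i
    using dmin_pos n inj inj\<xi> that by blast+
  have E: "0 \<le> rel_err p n \<xi> x" using rel_err_nonneg n p by blast
  have K: "2 / dmin av n \<xi> i \<le> K" if "i < n" for i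
    unfolding K_def using d that by (intro member_le_sum) (auto intro: less_imp_le)
  have near: "2 * av (x i - \<xi> i) \<le> dmin av n x i" if "i < n" for i
    using av_diff_le_rel_err [OF p n inj that, of \<xi>] mult_right_mono [OF half, of "dmin av n x i"] d [OF that]
    by linarith
  have "dmin av n \<xi> i \<le> 2 * dmin av n x i" if "i < n" for i
  proof -
    have "dmin av n \<xi> i / 2 \<le> dmin av n x i"
    proof (rule le_dmin [OF n])
      fix j assume "j < n" "j \<noteq> i"
      then show "dmin av n \<xi> i / 2 \<le> av (x i - x j)"
        using dmin_le [of i n j \<xi>] dmin_le [of i n j x] dmin_le' [of i n j x] that near [of i] near [of j]
          av_diff_triangle [of "\<xi> i" "\<xi> j" "x i"] av_diff_triangle [of "x i" "\<xi> j" "x j"]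
          av_commute [of "\<xi> i" "x i"] by simp
    qed
    then show ?thesis by simp
  qed
  then have "av (x i - \<xi> i) / dmin av n x i \<le> K * av (x i - \<xi> i)" if "i < n" for i
  proof -
    have "1 / dmin av n x i \<le> 2 / dmin av n \<xi> i"
      using d [OF that] \<open>\<And>i. i < n \<Longrightarrow> dmin av n \<xi> i \<le> 2 * dmin av n x i\<close> that by (simp add: field_simps)
    then have "1 / dmin av n x i \<le> K" using K [OF that] by linarith
    then show ?thesis using mult_right_mono [of "1 / dmin av n x i" K "av (x i - \<xi> i)"] by simp
  qed
  moreover have "0 \<le> K" unfolding K_def using d by (intro sum_nonneg) (auto intro: less_imp_le)
  ultimately have "rel_err p n \<xi> x \<le> pnorm p n (\<lambda>i. K * av (x i - \<xi> i))"
    unfolding rel_err_def using n p d by (intro pnorm_mono) (auto simp: abs_of_pos)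
  also have "\<dots> = K * pnorm p n (\<lambda>i. av (x i - \<xi> i))"
    using n p \<open>0 \<le> K\<close> by (intro pnorm_cmult) auto
  finally show ?thesis by (simp add: K_def)
qed

text \<open>Taking norms in the bound by W gives alpha E_f = h in the full p-norm; the componentwise
  discs of radius h d_i would give it only in the maximum norm.\<close>

lemma rel_err_root_vector_near:
  assumes n: "2 \<le> n" and p: "1 \<le> p" and inj: "inj_on x {..<n}"
    and t: "E_f av p f n x \<le> 1 / (1 + sqrt (a_param n p))\<^sup>2"
    and \<xi>: "\<And>i. i < n \<Longrightarrow> av (x i - \<xi> i) \<le> alpha_fun (a_param n p) (E_f av p f n x) * av (W_corr f n x i)"
  shows "rel_err p n \<xi> x \<le> h_fun (a_param n p) (E_f av p f n x)"
proof -
  have t0: "0 \<le> E_f av p f n x" unfolding E_f_def using n p by (intro pnorm_nonneg) auto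
  define \<alpha> where "\<alpha> = alpha_fun (a_param n p) (E_f av p f n x)"
  have "0 < \<alpha>" unfolding \<alpha>_def using h_fun_props(1) a_param_ge_1 n p t t0 by blast
  have d: "0 < dmin av n x i" if "i < n" for i using dmin_pos n inj that by blast
  have "av (x i - \<xi> i) / dmin av n x i \<le> \<alpha> * (av (W_corr f n x i) / dmin av n x i)" if "i < n" for i
    using \<xi> [OF that] d [OF that] by (simp add: \<alpha>_def divide_right_mono)
  then have "rel_err p n \<xi> x \<le> pnorm p n (\<lambda>i. \<alpha> * (av (W_corr f n x i) / dmin av n x i))"
    unfolding rel_err_def using n p d \<open>0 < \<alpha>\<close> by (intro pnorm_mono) (auto simp: abs_of_pos abs_mult)
  also have "\<dots> = \<alpha> * E_f av p f n x"
    unfolding E_f_def using n p \<open>0 < \<alpha>\<close> by (intro pnorm_cmult) auto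
  finally show ?thesis by (simp add: h_fun_def \<alpha>_def mult.commute)
qed

end

theorem theorem3p2:
  fixes av :: "'a::field \<Rightarrow> real" and f :: "'a poly" and n N :: nat and p :: ereal
    and x0 :: "nat \<Rightarrow> 'a"
  assumes absval: "is_absval av"
    and algclosed: "alg_closed_field TYPE('a)"
    and deg: "degree f = n" and n2: "n \<ge> 2"
    and N1: "N \<ge> 1"
    and p1: "1 \<le> p"
    and distinct: "\<forall>i<n. \<forall>j<n. i \<noteq> j \<longrightarrow> x0 i \<noteq> x0 j"
    and init1: "E_f av p f n x0 \<le> 1 / (1 + sqrt (a_param n p))\<^sup>2"
    and init2: "Omega n p (a_param n p) (E_f av p f n x0) < 2"
    and strict: "n = 2 \<and> p = \<infinity> \<longrightarrow> E_f av p f n x0 < 1 / (1 + sqrt (a_param n p))\<^sup>2"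
  shows "(\<forall>z. poly f z = 0 \<longrightarrow> order z f = 1) \<and>
         (\<forall>k. ((T_map f n N) ^^ k) x0 \<in> D_dom f n N) \<and>
         (\<exists>\<xi>. root_vector f n \<xi> \<and>
            (\<forall>i<n. (\<lambda>k. av (((T_map f n N) ^^ k) x0 i - \<xi> i)) \<longlonglongrightarrow> 0) \<and>
            (\<exists>C. \<forall>k. pnorm p n (\<lambda>i. av (((T_map f n N) ^^ Suc k) x0 i - \<xi> i))
                   \<le> C * (pnorm p n (\<lambda>i. av (((T_map f n N) ^^ k) x0 i - \<xi> i))) ^ (N + 1)) \<and>
            (\<forall>k. E_f av p f n (((T_map f n N) ^^ k) x0) \<le> 1 / (1 + sqrt (a_param n p))\<^sup>2 \<and>
                 Omega n p (a_param n p) (E_f av p f n (((T_map f n N) ^^ k) x0)) < 2 \<longrightarrow>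
                 (\<forall>i<n. av (((T_map f n N) ^^ k) x0 i - \<xi> i)
                    \<le> alpha_fun (a_param n p) (E_f av p f n (((T_map f n N) ^^ k) x0))
                      * av (W_corr f n (((T_map f n N) ^^ k) x0) i))))"
proof -
  interpret absval av by unfold_locales (rule absval)
  obtain M where N: "N = Suc M" using N1 by (cases N) auto
  have fnz: "f \<noteq> 0" using deg n2 by auto
  have n0: "0 < n" using n2 by simp
  have inj0: "inj_on x0 {..<n}" using distinct by (auto simp: inj_on_def)
  obtain \<xi> where f: "f = smult (lead_coeff f) (\<Prod>i<n. [:- \<xi> i, 1:])"
    and \<xi>: "\<And>i. i < n \<Longrightarrow> av (x0 i - \<xi> i) \<le> alpha_fun (a_param n p) (E_f av p f n x0) * av (W_corr f n x0 i)"
    using root_vector_near [OF algclosed deg n2 p1 inj0 init1 init2] by metis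
  define E where "E = rel_err p n \<xi> x0"
  have E0: "0 \<le> E" unfolding E_def using rel_err_nonneg n2 p1 by blast
  \<comment> \<open>This replaces E_f(x0) by the true relative error; the rest of the iteration is
    driven by Psi(E) < 2 alone.\<close>
  have "E \<le> h_fun (a_param n p) (E_f av p f n x0)"
    unfolding E_def by (rule rel_err_root_vector_near [OF n2 p1 inj0 init1 \<xi>])
  then have PsiE: "Psi n p E < 2"
    using Psi_mono [OF p1 n2 E0] init2 by (fastforce simp: Omega_def)
  have Ehalf: "2 * E < 1" using Psi_less_2_imp(1) [OF p1 n2 E0 PsiE] by simp

  define X where "X k = ((T_map f n N) ^^ k) x0" for k
  define e where "e k = rel_err p n \<xi> (X k)" for k
  have e0: "0 \<le> e k" for k unfolding e_def using rel_err_nonneg n2 p1 by blast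
  have Psi_e: "Psi n p (e k) < 2" if "e k \<le> E" for k
    using Psi_mono [OF p1 n2 e0 that] PsiE by simp
  \<comment> \<open>The contraction factor of step k, kept dependent on \<open>e k\<close>: a
    uniform bound on it yields convergence, its smallness yields the order.\<close>
  define L where "L k = beta_fun n p (e k) * (beta_fun n p (e k) * (1 + 2 * e k)) ^ M" for k
  have step: "X k \<in> D_dom f n N \<and> (\<forall>i<n. av (X (Suc k) i - \<xi> i) \<le> L k * av (X k i - \<xi> i))"
    if "inj_on (X k) {..<n}" "e k \<le> E" for k
    using T_map_error [OF f fnz n2 p1 that(1) Psi_e [OF that(2), unfolded e_def], of M]
    by (simp add: X_def L_def e_def N)
  have L: "L k \<le> beta_fun n p (e k)" if "e k \<le> E" for k
  proof -
    note \<beta> = beta_fun_bounds [OF e0 Psi_e [OF that]]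
    have "(beta_fun n p (e k) * (1 + 2 * e k)) ^ M \<le> 1"
      using \<beta> e0 [of k] by (intro power_le_one mult_nonneg_nonneg) auto
    then show ?thesis using mult_left_mono [OF _ \<beta>(1)] by (fastforce simp: L_def)
  qed
  have inv: "inj_on (X k) {..<n} \<and> e k \<le> E" for k
  proof (induction k)
    case 0
    then show ?case by (simp add: X_def e_def E_def inj0)
  next
    case (Suc k)
    then have IH: "inj_on (X k) {..<n}" "e k \<le> E" by auto
    have "av (X (Suc k) i - \<xi> i) \<le> beta_fun n p (e k) * av (X k i - \<xi> i)" if "i < n" for i
      using step [OF IH] that mult_right_mono [OF L [OF IH(2)] av_nonneg] by (blast intro: order_trans)
    then show ?case
      using T_map_rel_err [OF n2 p1 IH(1) Psi_e [OF IH(2), unfolded e_def], of "X (Suc k)"] IH(2)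
      by (auto simp: e_def)
  qed
  have inj: "inj_on (X k) {..<n}" and e: "e k \<le> E" for k using inv by auto

  have dom: "\<forall>k. X k \<in> D_dom f n N" using step inj e by blast
  have near: "2 * av (X k i - \<xi> i) < dmin av n (X k) i" if "i < n" for k i
  proof -
    have "2 * e k < 1" using e [of k] Ehalf by simp
    then have "2 * e k * dmin av n (X k) i < 1 * dmin av n (X k) i"
      using dmin_pos [OF n2 that inj [of k]] by (intro mult_strict_right_mono) auto
    then show ?thesis
      using av_diff_le_rel_err [OF p1 n2 inj [of k] that, of \<xi>] by (simp add: e_def)
  qed
  have inj\<xi>: "inj_on \<xi> {..<n}"
  proof (rule inj_onI, rule ccontr)
    fix i j assume ij: "i \<in> {..<n}" "j \<in> {..<n}" "\<xi> i = \<xi> j" "i \<noteq> j"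
    then show False
      using near [of i 0] near [of j 0] dmin_le [of i n j "X 0"] dmin_le' [of i n j "X 0"]
        av_diff_triangle [of "X 0 i" "X 0 j" "\<xi> i"] av_commute [of "X 0 j" "\<xi> j"] by simp
  qed
  have rv: "root_vector f n \<xi>" by (rule root_vectorI_prod [OF f])
  have simple: "\<forall>z. poly f z = 0 \<longrightarrow> order z f = 1"
    using order_prod_distinct_linear [OF f _ inj\<xi>] fnz by simp

  define q where "q = beta_fun n p E"
  have q: "0 \<le> q" "q < 1"
  proof -
    note \<beta> = beta_fun_bounds [OF E0 PsiE, folded q_def]
    show "0 \<le> q" by (rule \<beta>(1))
    have "q * 1 \<le> q * (1 + 2 * E)" using E0 \<beta>(1) by (intro mult_left_mono) auto
    then show "q < 1" using \<beta>(2) E0 by linarith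
  qed
  have geometric: "av (X k i - \<xi> i) \<le> q ^ k * av (x0 i - \<xi> i)" if "i < n" for k i
  proof (induction k)
    case (Suc k)
    have "L k \<le> q" using L [OF e] beta_fun_mono [OF n2 e0 e] by (metis order_trans q_def)
    then have "L k * av (X k i - \<xi> i) \<le> q * (q ^ k * av (x0 i - \<xi> i))"
      using Suc.IH q by (intro mult_mono) auto
    moreover have "av (X (Suc k) i - \<xi> i) \<le> L k * av (X k i - \<xi> i)"
      using step [OF inj e] that by blast
    ultimately show ?case by (simp add: mult.assoc)
  qed (simp add: X_def)
  have conv: "\<forall>i<n. (\<lambda>k. av (X k i - \<xi> i)) \<longlonglongrightarrow> 0"
  proof (intro allI impI)
    fix i assume i: "i < n"
    have "(\<lambda>k. q ^ k * av (x0 i - \<xi> i)) \<longlonglongrightarrow> 0"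
      using q by (intro tendsto_mult_left_zero LIMSEQ_realpow_zero)
    moreover have "\<forall>\<^sub>F k in sequentially. av (X k i - \<xi> i) \<le> q ^ k * av (x0 i - \<xi> i)"
      using geometric [OF i] by simp
    ultimately show "(\<lambda>k. av (X k i - \<xi> i)) \<longlonglongrightarrow> 0"
      by (intro tendsto_sandwich [of "\<lambda>_. 0" "\<lambda>k. av (X k i - \<xi> i)" sequentially "\<lambda>k. q ^ k * av (x0 i - \<xi> i)"]) simp_all
  qed

  define c where "c = beta_fun n p 1"
  have c: "0 \<le> c" using n2 by (simp add: c_def beta_fun_def one_le_power)
  define K where "K = (\<Sum>i<n. 2 / dmin av n \<xi> i)"
  have K: "0 \<le> K" unfolding K_def
    using dmin_pos [OF n2 _ inj\<xi>] by (intro sum_nonneg) (auto intro: less_imp_le)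
  \<comment> \<open>From beta <= c e_k and 1 + 2 e_k <= 2 follows L k <= c e_k (2 c e_k)^M. Each of
    the N = M + 1 factors e_k is at most K times the norm of the error.\<close>
  define C where "C = c * (2 * c) ^ M * K ^ N"
  have order: "pnorm p n (\<lambda>i. av (X (Suc k) i - \<xi> i)) \<le> C * pnorm p n (\<lambda>i. av (X k i - \<xi> i)) ^ (N + 1)" for k
  proof -
    define D where "D = pnorm p n (\<lambda>i. av (X k i - \<xi> i))"
    have D: "0 \<le> D" unfolding D_def by (rule pnorm_nonneg [OF p1 n0])
    have ek: "0 \<le> e k" "2 * e k \<le> 1" using e0 e [of k] Ehalf by auto
    have \<beta>: "0 \<le> beta_fun n p (e k)" "beta_fun n p (e k) \<le> e k * c"
      using beta_fun_bounds(1) [OF e0 Psi_e [OF e]] beta_fun_le_linear [of "e k" n p] ek by (auto simp: c_def)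
    have "beta_fun n p (e k) * (1 + 2 * e k) \<le> (e k * c) * 2"
      using \<beta> ek c by (intro mult_mono) auto
    then have "L k \<le> (e k * c) * ((e k * c) * 2) ^ M"
      unfolding L_def using \<beta> ek c by (intro mult_mono power_mono) auto
    also have "\<dots> = c * (2 * c) ^ M * e k ^ N"
      by (simp add: N power_mult_distrib)
    also have "\<dots> \<le> c * (2 * c) ^ M * (K * D) ^ N"
      using rel_err_le_pnorm [OF n2 p1 inj _ inj\<xi>, of k] ek c
      by (intro mult_left_mono power_mono) (auto simp: e_def K_def D_def)
    also have "\<dots> = C * D ^ N" by (simp add: C_def power_mult_distrib)
    finally have Lk: "L k \<le> C * D ^ N" .
    have Lk0: "0 \<le> L k" unfolding L_def using \<beta> ek by auto
    have "pnorm p n (\<lambda>i. av (X (Suc k) i - \<xi> i)) \<le> pnorm p n (\<lambda>i. L k * av (X k i - \<xi> i))"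
      using step [OF inj e] Lk0 by (intro pnorm_mono [OF p1 n0]) (auto simp: abs_mult)
    also have "\<dots> = L k * D" unfolding D_def by (rule pnorm_cmult [OF p1 n0 Lk0])
    also have "\<dots> \<le> C * D ^ N * D" using Lk D by (rule mult_right_mono)
    finally show ?thesis by (simp add: D_def mult_ac)
  qed

  have estimate: "av (X k i - \<xi> i) \<le> alpha_fun (a_param n p) (E_f av p f n (X k)) * av (W_corr f n (X k) i)"
    if t: "E_f av p f n (X k) \<le> 1 / (1 + sqrt (a_param n p))\<^sup>2"
      and Om: "Omega n p (a_param n p) (E_f av p f n (X k)) < 2" and i: "i < n" for k i
  proof -
    \<comment> \<open>Localization around X k yields a root-vector of its own. Both
      \<open>\<eta>\<close> and \<open>\<xi>\<close> lie within d_i/2 of X k, so their components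
      agree.\<close>
    obtain \<eta> where \<eta>: "f = smult (lead_coeff f) (\<Prod>i<n. [:- \<eta> i, 1:])"
      "\<And>i. i < n \<Longrightarrow> av (X k i - \<eta> i) \<le> h_fun (a_param n p) (E_f av p f n (X k)) * dmin av n (X k) i"
      "\<And>i. i < n \<Longrightarrow> av (X k i - \<eta> i) \<le> alpha_fun (a_param n p) (E_f av p f n (X k)) * av (W_corr f n (X k) i)"
      using root_vector_near [OF algclosed deg n2 p1 inj t Om] by metis
    have "0 \<le> E_f av p f n (X k)" unfolding E_f_def by (rule pnorm_nonneg [OF p1 n0])
    then have "0 \<le> h_fun (a_param n p) (E_f av p f n (X k))"
      using h_fun_props(2) a_param_ge_1 [OF p1 n2] t by blast
    then have h: "h_fun (a_param n p) (E_f av p f n (X k)) < 1 / 2"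
      using Psi_less_2_imp(1) [OF p1 n2] Om by (simp add: Omega_def)
    have "2 * av (X k i - \<eta> i) < dmin av n (X k) i" if "i < n" for i
      using \<eta>(2) [OF that] mult_strict_right_mono [OF h dmin_pos [OF n2 that inj [of k]]] by simp
    then have "\<eta> i = \<xi> i"
      using near_root_vector_unique [OF rv root_vectorI_prod [OF \<eta>(1)] fnz near] i by blast
    then show ?thesis using \<eta>(3) [OF i] by simp
  qed
  show ?thesis
    using simple dom rv conv order estimate unfolding X_def by blast
qed

end
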